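(* Let $X\subset\mathcal M^B$ be bounded, and let $r,\Delta_s>0$ and the maps $\delta_x:V_x^B(\Delta_s)\to S_r$, $x\in X$, be as defined in the context. Then for every $x\in X$, $\delta_x$ is of class $C^2$ on $V_x^B(\Delta_s)$.
   Context: $\mathcal E,\mathcal Y$ are real Hilbert spaces, $\mathcal Y\neq\{0\}$. $\mathcal M\subset\mathcal E$ is a $C^2$ embedded submanifold; for $x\in\mathcal M$ the tangent space $T_x\mathcal M$ is identified with a closed linear subspace of $\mathcal E$ with the ambient norm. $B:\mathcal E\to\mathcal Y$ is a surjective bounded linear operator with adjoint $B^*$, $c\in\mathcal Y$, and $\mathcal M^B:=\{x\in\mathcal M: Bx=c\}$ is nonempty. For each $x\in\mathcal M$ a bounded linear projection $P_x:\mathcal E\to T_x\mathcal M$ onto $T_x\mathcal M$ is given (not necessarily orthogonal), and $L_x:=BP_xB^*:\mathcal Y\to\mathcal Y$. For each $x\in\mathcal M$ a $C^2$ map $R_x:T_x\mathcal M\to\mathcal M$ is given with $R_x(0)=x$, $DR_x(0)=\mathrm{Id}_{T_x\mathcal M}$. Standing assumptions: (A1) for every bounded $S\subset\mathcal M^B$ there is $C_S>0$ with $(L_x\delta,\delta)_{\mathcal Y}\ge C_S\|\delta\|_{\mathcal Y}^2$ for all $x\in S$, $\delta\in\mathcal Y$; (A2) the map $\mathcal M\to\mathcal L(\mathcal E,\mathcal E)$, $x\mapsto P_x$, is continuous and maps bounded sets to bounded sets; (A3) for every bounded $S\subset\mathcal M$ there are $\sigma,K_1,K_2>0$ such that $\|DR_x(u)\|\le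 K_1$ and $\|D^2R_x(u)\|\le K_2$ for all $x\in S$ and $u\in T_x\mathcal M$ with $\|u\|_{\mathcal E}\le\sigma$ (operator norms, $R_x$ viewed as a map into $\mathcal E$). Under (A1), $L_x$ is invertible and $\mathcal M^B$ is a $C^2$ Hilbert submanifold with $T_x\mathcal M^B=T_x\mathcal M\cap\ker B$. Constants for the bounded set $X$: $K_P,K_L>0$ with $\|P_x\|\le K_P$ and $\|L_x^{-1}\|\le K_L$ for all $x\in X$; $\sigma,K_1,K_2>0$ as in (A3) for $S=X$. Put $$r:=\min\Bigl\{\tfrac{\sigma}{2K_P\|B\|},\tfrac{1}{4K_2K_LK_P^2\|B\|^3}\Bigr\},\qquad \Delta_s:=\min\Bigl\{\tfrac{\sigma}{2},\tfrac{1}{4K_2K_LK_P\|B\|^2},\tfrac{r}{2K_1K_L\|B\|}\Bigr\},$$ $V_x^B(\rho):=\{v\in T_x\mathcal M^B:\|v\|_{\mathcal E}<\rho\}$, $S_r:=\{\delta\in\mathcal Y:\|\delta\|_{\mathcal Y}\le r\}$. For $x\in X$ and $v\in V_x^B(\Delta_s)$, $\delta_x(v)$ is the unique element $\delta\in S_r$ with $BR_x(v-P_xB^*\delta)=c$ (existence and uniqueness are known; $\delta_x$ is continuous and $\delta_x(0)=0$). *)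

theory Defs
  imports "HOL-Analysis.Analysis"
begin

(* f' and f'' are the first and second Frechet derivatives of the C^2 map f on the set D, an open
   subset of the Hilbert space T, a closed subspace of the ambient type. Elements of L(T, 'b) are
   represented by bounded linear maps on the whole type. As T is complemented, each of them extends,
   and composing with a bounded projection onto T extends f' and f'' without loss of regularity;
   only the restrictions of f' u and f'' u to T are determined by f. T = UNIV gives the usual notion. *)
definition has_C2_derivs ::
  "'a::{real_inner, complete_space} set \<Rightarrow> 'a set \<Rightarrow> ('a \<Rightarrow> 'b::real_normed_vector) \<Rightarrow>
   ('a \<Rightarrow> 'a \<Rightarrow>\<^sub>L 'b) \<Rightarrow> ('a \<Rightarrow> 'a \<Rightarrow>\<^sub>L 'a \<Rightarrow>\<^sub>L 'b) \<Rightarrow> bool" where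
  "has_C2_derivs T D f f' f'' \<longleftrightarrow>
     subspace T \<and> closed T \<and> openin (top_of_set T) D \<and>
     (\<forall>u\<in>D. (f has_derivative blinfun_apply (f' u)) (at u within D)) \<and>
     (\<forall>u\<in>D. (f' has_derivative blinfun_apply (f'' u)) (at u within D)) \<and>
     continuous_on D f''"

definition C2_on ::
  "'a::{real_inner, complete_space} set \<Rightarrow> 'a set \<Rightarrow> ('a \<Rightarrow> 'b::real_normed_vector) \<Rightarrow> bool" where
  "C2_on T D f \<longleftrightarrow> (\<exists>f' f''. has_C2_derivs T D f f' f'')"

(* Embedded submanifold: near each of its points, a C^2 diffeomorphism of open sets of the ambient
   space straightens M to a closed linear subspace (closed subspaces of a Hilbert space split). *)
definition C2_submanifold :: "'a::{real_inner, complete_space} set \<Rightarrow> bool" where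
  "C2_submanifold M \<longleftrightarrow>
     (\<forall>x\<in>M. \<exists>U V F. \<exists>\<phi> \<psi> :: 'a \<Rightarrow> 'a. open U \<and> open V \<and> x \<in> U \<and> homeomorphism U V \<phi> \<psi> \<and>
        C2_on UNIV U \<phi> \<and> C2_on UNIV V \<psi> \<and>
        subspace F \<and> closed F \<and> \<phi> ` (U \<inter> M) = V \<inter> F)"

definition tangent_space :: "'a::{real_inner, complete_space} set \<Rightarrow> 'a \<Rightarrow> 'a set" where
  "tangent_space M x =
     {v. \<exists>\<gamma> \<epsilon>. \<epsilon> > 0 \<and> \<gamma> C1_differentiable_on {-\<epsilon><..<\<epsilon>} \<and> \<gamma> ` {-\<epsilon><..<\<epsilon>} \<subseteq> M \<and>
        \<gamma> 0 = x \<and> (\<gamma> has_vector_derivative v) (at 0)}"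

definition constraint_set ::
  "'e::{real_inner, complete_space} set \<Rightarrow> ('e \<Rightarrow>\<^sub>L 'y::{real_inner, complete_space}) \<Rightarrow> 'y \<Rightarrow> 'e set" where
  "constraint_set M B c = {x \<in> M. B x = c}"

definition schur_op ::
  "('e::{real_inner, complete_space} \<Rightarrow>\<^sub>L 'y::{real_inner, complete_space}) \<Rightarrow>
   ('e \<Rightarrow> 'e \<Rightarrow>\<^sub>L 'e) \<Rightarrow> 'e \<Rightarrow> 'y \<Rightarrow> 'y" where
  "schur_op B P x \<delta> = B (P x (adjoint B \<delta>))"

(* DR x u and D2R x u are the derivatives of R x at u; the operator norms in L(T, E) and
   L(T, L(T, E)), T the tangent space at x, only test directions in T. *)
definition retraction_bounds ::
  "'e::{real_inner, complete_space} set \<Rightarrow> ('e \<Rightarrow> 'e \<Rightarrow> 'e \<Rightarrow>\<^sub>L 'e) \<Rightarrow>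
   ('e \<Rightarrow> 'e \<Rightarrow> 'e \<Rightarrow>\<^sub>L 'e \<Rightarrow>\<^sub>L 'e) \<Rightarrow> 'e set \<Rightarrow> real \<Rightarrow> real \<Rightarrow> real \<Rightarrow> bool" where
  "retraction_bounds M DR D2R S \<sigma> K1 K2 \<longleftrightarrow>
     (\<forall>x\<in>S. \<forall>u\<in>tangent_space M x. norm u \<le> \<sigma> \<longrightarrow>
        (\<forall>v\<in>tangent_space M x. norm (DR x u v) \<le> K1 * norm v) \<and>
        (\<forall>v\<in>tangent_space M x. \<forall>w\<in>tangent_space M x.
           norm (D2R x u v w) \<le> K2 * norm v * norm w))"

definition correction ::
  "('e::{real_inner, complete_space} \<Rightarrow>\<^sub>L 'y::{real_inner, complete_space}) \<Rightarrow> 'y \<Rightarrow>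
   ('e \<Rightarrow> 'e \<Rightarrow>\<^sub>L 'e) \<Rightarrow> ('e \<Rightarrow> 'e \<Rightarrow> 'e) \<Rightarrow> real \<Rightarrow> 'e \<Rightarrow> 'e \<Rightarrow> 'y" where
  "correction B c P R r x v =
     (THE \<delta>. norm \<delta> \<le> r \<and> B (R x (v - P x (adjoint B \<delta>))) = c)"

end

theory Submission
  imports Defs
begin

text \<open>
  Fix \<open>x \<in> X\<close> and write \<open>P\<close>, \<open>L\<close>, \<open>R\<close> for \<open>P\<^sub>x\<close>, \<open>L\<^sub>x\<close>, \<open>R\<^sub>x\<close>. The correction \<open>\<delta>(v)\<close> solves
  \<open>B (R (v - P B\<^sup>* \<delta>)) = c\<close>, and at the origin the derivative of the left side in \<open>\<delta>\<close> is \<open>- L\<close>.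
  The simplified Newton map \<open>\<delta> \<mapsto> \<delta> + L\<^sup>-\<^sup>1 (B (R (v - P B\<^sup>* \<delta>)) - c)\<close> therefore contracts as long as
  \<open>DR\<close> stays close to the identity, and the constants \<open>r\<close> and \<open>\<Delta>\<^sub>s\<close> are chosen so that it
  contracts the closed ball of radius \<open>r\<close> with factor \<open>1/2\<close> and maps that ball into itself
  (\<open>newton_contraction\<close>, \<open>newton_zero\<close>). Three consequences follow from this one estimate: the
  solution exists and is unique; it depends on \<open>v\<close> in a Lipschitz way, because the Newton map does
  (\<open>corr_lipschitz\<close>); and the partial derivative of the equation in \<open>\<delta>\<close> is invertible at every
  solution, with inverse bounded by \<open>2 K\<^sub>L\<close> (\<open>partial_derivative_invertible\<close>). These are the
  hypotheses of the implicit function theorem \<open>implicit_C2\<close>, which yields the regularity.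

  Regularity is proved on an open subset of the whole ambient space: replacing \<open>R\<close> by
  \<open>R \<circ> P\<close> extends the equation from the tangent space to all of \<open>\<E>\<close>, and the extended solution
  map restricts to the correction on the ball in \<open>T\<^sub>x\<M>\<^sup>B\<close>. What remains is that \<open>T\<^sub>x\<M>\<^sup>B\<close>,
  defined by velocities of curves, is a closed subspace. It equals \<open>T\<^sub>x\<M> \<inter> ker B\<close>: for \<open>v\<close> in
  the latter the curve \<open>t \<mapsto> R (t v - P B\<^sup>* \<delta>(t v))\<close> stays in \<open>\<M>\<^sup>B\<close>, is \<open>C\<^sup>1\<close> by the regularity
  of \<open>\<delta>\<close>, and has initial velocity \<open>v\<close> because \<open>D\<delta>(0) v = 0\<close> (\<open>constrained_curve\<close>).

  Two facts about Hilbert spaces enter through the operators: the adjoint of \<open>B\<close> exists by the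
  Riesz representation theorem, and the coercive operator \<open>L\<close> is invertible by the Lax--Milgram
  theorem.
\<close>

section \<open>Riesz representation, adjoints and Lax--Milgram\<close>

text \<open>
  By the parallelogram law, the squared distance of two points is controlled by how far both
  are from minimising \<open>\<phi>\<close>, so every minimising sequence is Cauchy. The minimiser represents \<open>f\<close>.
\<close>
lemma quadratic_functional_minimiser:
  fixes f :: "'a::{real_inner, complete_space} \<Rightarrow>\<^sub>L real"
  defines "\<phi> \<equiv> \<lambda>x. (norm x)\<^sup>2 / 2 - f x"
  obtains z where "\<And>x. \<phi> z \<le> \<phi> x"
proof -
  define m where "m = (INF x. \<phi> x)"
  have low: "- (norm f)\<^sup>2 / 2 \<le> \<phi> x" for x
  proof -
    have "f x \<le> norm f * norm x"
      using norm_blinfun[of f x] by simp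
    moreover have "0 \<le> (norm f - norm x)\<^sup>2" by simp
    ultimately show ?thesis
      unfolding \<phi>_def by (simp add: power2_diff)
  qed
  have bdd: "bdd_below (range \<phi>)"
    using low by (meson bdd_belowI2)
  have m_le: "m \<le> \<phi> x" for x
    unfolding m_def by (rule cINF_lower[OF bdd]) simp
  have "\<exists>x. \<phi> x < m + 1 / real (Suc n)" for n
  proof -
    have "(INF x. \<phi> x) < m + 1 / real (Suc n)" by (simp add: m_def)
    thus ?thesis
      using cINF_less_iff[OF _ bdd] by auto
  qed
  then obtain x where x: "\<And>n. \<phi> (x n) < m + 1 / real (Suc n)" by metis
  have parallelogram: "(norm (a - b))\<^sup>2 / 4 \<le> \<phi> a + \<phi> b - 2 * m" for a b
  proof -
    have "(norm (a - b))\<^sup>2 / 4 = \<phi> a + \<phi> b - 2 * \<phi> ((1/2) *\<^sub>R (a + b))"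
      unfolding \<phi>_def
      by (simp add: power2_norm_eq_inner inner_add inner_diff inner_commute
          blinfun.add_right blinfun.scaleR_right field_simps)
    thus ?thesis using m_le[of "(1/2) *\<^sub>R (a + b)"] by linarith
  qed
  have "Cauchy x"
  proof (rule metric_CauchyI)
    fix e :: real assume "e > 0"
    then obtain N where N: "inverse (real (Suc N)) < e\<^sup>2 / 8"
      using reals_Archimedean[of "e\<^sup>2 / 8"] by auto
    have bound: "\<phi> (x n) < m + e\<^sup>2 / 8" if "n \<ge> N" for n
    proof -
      have "1 / real (Suc n) \<le> inverse (real (Suc N))"
        using that by (simp add: field_simps)
      thus ?thesis using x[of n] N by linarith
    qed
    have "dist (x n) (x k) < e" if "n \<ge> N" "k \<ge> N" for n k
    proof -
      have "(norm (x n - x k))\<^sup>2 < e\<^sup>2"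
        using parallelogram[of "x n" "x k"] bound[OF that(1)] bound[OF that(2)] by linarith
      thus ?thesis
        using \<open>e > 0\<close> by (simp add: dist_norm power_less_imp_less_base)
    qed
    thus "\<exists>N. \<forall>n\<ge>N. \<forall>k\<ge>N. dist (x n) (x k) < e" by blast
  qed
  then obtain z where z: "x \<longlonglongrightarrow> z"
    using Cauchy_convergent convergent_def by blast
  have "(\<lambda>n. \<phi> (x n)) \<longlonglongrightarrow> \<phi> z"
    unfolding \<phi>_def by (intro tendsto_intros z) simp
  moreover have "(\<lambda>n. m + 1 / real (Suc n)) \<longlonglongrightarrow> m + 0"
    using LIMSEQ_Suc[OF lim_1_over_n] by (intro tendsto_intros) auto
  ultimately have "\<phi> z \<le> m + 0"
    by (rule LIMSEQ_le) (use x less_imp_le in blast)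
  thus ?thesis using that[of z] m_le by (metis add.right_neutral order_trans)
qed

text \<open>
  The first variation of the quadratic functional vanishes at its minimiser \<open>z\<close>, which says
  \<open>z \<bullet> h = f h\<close>.
\<close>
lemma riesz_representation:
  fixes f :: "'a::{real_inner, complete_space} \<Rightarrow>\<^sub>L real"
  obtains z where "\<And>x. f x = x \<bullet> z"
proof -
  obtain z where z: "\<And>x. (norm z)\<^sup>2 / 2 - f z \<le> (norm x)\<^sup>2 / 2 - f x"
    using quadratic_functional_minimiser by blast
  have "f h = h \<bullet> z" for h
  proof -
    define a where "a = f h - h \<bullet> z"
    define s where "s = (norm h)\<^sup>2"
    \<comment> \<open>A step in the direction of descent; \<open>s + 1\<close> rather than \<open>s\<close> covers \<open>h = 0\<close>.\<close>
    define t where "t = a / (s + 1)"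
    have s: "s \<ge> 0" by (simp add: s_def)
    have "(norm (z + t *\<^sub>R h))\<^sup>2 = (norm z)\<^sup>2 + 2 * (t * (h \<bullet> z)) + t\<^sup>2 * s"
      unfolding s_def power2_norm_eq_inner
      by (simp add: inner_add inner_commute algebra_simps power2_eq_square)
    hence "0 \<le> t\<^sup>2 * s / 2 - t * a"
      using z[of "z + t *\<^sub>R h"] unfolding a_def
      by (simp add: blinfun.add_right blinfun.scaleR_right algebra_simps)
    moreover have "t * a = t\<^sup>2 * (s + 1)"
      using s by (simp add: t_def power2_eq_square)
    ultimately have "t\<^sup>2 * (s / 2 + 1) \<le> 0" by (simp add: algebra_simps)
    hence "t = 0"
      using s by (simp add: mult_le_0_iff)
    thus ?thesis using s by (simp add: t_def a_def)
  qed
  thus ?thesis using that by blast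
qed

lemma inner_adjoint:
  fixes B :: "'a::{real_inner, complete_space} \<Rightarrow>\<^sub>L 'b::real_inner"
  shows "B x \<bullet> y = x \<bullet> adjoint B y"
proof -
  have "\<exists>z. \<forall>x. B x \<bullet> y = x \<bullet> z" for y
  proof -
    have bl: "bounded_linear (\<lambda>x. B x \<bullet> y)"
      by (intro bounded_linear_intros)
    show ?thesis
      using riesz_representation[of "Blinfun (\<lambda>x. B x \<bullet> y)"]
      by (metis bounded_linear_Blinfun_apply[OF bl])
  qed
  then obtain g where "\<And>x y. B x \<bullet> y = x \<bullet> g y" by metis
  thus ?thesis using adjoint_unique[of B g] by auto
qed

lemma norm_adjoint_le:
  fixes B :: "'a::{real_inner, complete_space} \<Rightarrow>\<^sub>L 'b::real_inner"
  shows "norm (adjoint B y) \<le> norm B * norm y"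
proof (cases "adjoint B y = 0")
  case False
  have "norm (adjoint B y) * norm (adjoint B y) = B (adjoint B y) \<bullet> y"
    by (simp add: inner_adjoint power2_norm_eq_inner[symmetric] power2_eq_square)
  also have "\<dots> \<le> norm (B (adjoint B y)) * norm y" by (rule norm_cauchy_schwarz)
  also have "\<dots> \<le> norm B * norm (adjoint B y) * norm y"
    by (intro mult_right_mono norm_blinfun) auto
  finally show ?thesis using False by (simp add: mult.commute mult.left_commute)
qed simp

lemma bounded_linear_adjoint:
  fixes B :: "'a::{real_inner, complete_space} \<Rightarrow>\<^sub>L 'b::real_inner"
  shows "bounded_linear (adjoint B)"
proof (rule bounded_linear_intro)
  show "adjoint B (x + y) = adjoint B x + adjoint B y" for x y
    by (subst vector_eq_ldot[symmetric]) (simp add: inner_adjoint[symmetric] inner_add_right)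
  show "adjoint B (r *\<^sub>R x) = r *\<^sub>R adjoint B x" for r x
    by (subst vector_eq_ldot[symmetric]) (simp add: inner_adjoint[symmetric])
  show "norm (adjoint B x) \<le> norm x * norm B" for x
    using norm_adjoint_le[of B x] by (simp add: mult.commute)
qed

text \<open>
  If \<open>S A\<close> is closer to the identity than \<open>1\<close>, then \<open>z \<mapsto> z - S (A z - y)\<close> is a contraction,
  and injectivity of \<open>S\<close> turns its fixed point into a solution of \<open>A z = y\<close>. This serves twice:
  with \<open>S\<close> a small multiple of the identity for coercive \<open>A\<close>, and with \<open>S\<close> the inverse of
  a nearby operator.
\<close>
lemma inverse_of_approximate_inverse:
  fixes A S :: "'b::{real_normed_vector, complete_space} \<Rightarrow>\<^sub>L 'b"
  assumes S: "inj S" and q: "0 \<le> q" "q < 1"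
    and approx: "\<And>z. norm (z - S (A z)) \<le> q * norm z"
  obtains I where "I o\<^sub>L A = id_blinfun" "A o\<^sub>L I = id_blinfun" "norm I \<le> norm S / (1 - q)"
proof -
  have lower: "(1 - q) * norm z \<le> norm S * norm (A z)" for z
  proof -
    have "norm z \<le> norm (z - S (A z)) + norm (S (A z))"
      using norm_triangle_ineq[of "z - S (A z)" "S (A z)"] by simp
    thus ?thesis using approx[of z] norm_blinfun[of S "A z"] by (simp add: algebra_simps)
  qed
  have "\<exists>z. A z = y" for y
  proof -
    have "\<exists>!z. z - S (A z - y) = z"
    proof (rule banach_fix_type[OF q], intro allI)
      fix a b
      have "a - S (A a - y) - (b - S (A b - y)) = (a - b) - S (A (a - b))"
        by (simp add: blinfun.diff_right)
      thus "dist (a - S (A a - y)) (b - S (A b - y)) \<le> q * dist a b"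
        unfolding dist_norm using approx[of "a - b"] by metis
    qed
    then obtain z where "S (A z - y) = S 0" by auto
    from injD[OF S this] show ?thesis by auto
  qed
  then obtain g where g: "\<And>y. A (g y) = y" by metis
  have inj: "a = b" if "A a = A b" for a b
    using lower[of "a - b"] that q by (simp add: blinfun.diff_right mult_le_0_iff)
  have bl: "bounded_linear g"
  proof (rule bounded_linear_intro)
    show "g (x + y) = g x + g y" for x y
      by (rule inj) (simp add: g blinfun.add_right)
    show "g (r *\<^sub>R x) = r *\<^sub>R g x" for r x
      by (rule inj) (simp add: g blinfun.scaleR_right)
    show "norm (g x) \<le> norm x * (norm S / (1 - q))" for x
      using lower[of "g x"] q by (simp add: g field_simps)
  qed
  note g_eq = bounded_linear_Blinfun_apply[OF bl]
  show ?thesis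
  proof (rule that[of "Blinfun g"])
    show "Blinfun g o\<^sub>L A = id_blinfun"
      by (rule blinfun_eqI) (auto simp: g_eq g intro: inj)
    show "A o\<^sub>L Blinfun g = id_blinfun"
      by (rule blinfun_eqI) (simp add: g_eq g)
    show "norm (Blinfun g) \<le> norm S / (1 - q)"
    proof (rule norm_blinfun_bound)
      show "norm (Blinfun g x) \<le> norm S / (1 - q) * norm x" for x
        using lower[of "g x"] q by (simp add: g g_eq field_simps)
    qed (use q in simp)
  qed
qed

text \<open>
  Expanding the square, \<open>z \<mapsto> z - \<rho> A z\<close> has norm at most \<open>sqrt (1 - 2 \<rho> C + \<rho>\<^sup>2 K\<^sup>2)\<close> whenever
  \<open>\<parallel>A\<parallel> \<le> K\<close>, and \<open>\<rho> = C / K\<^sup>2\<close> makes this smallest.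
\<close>
lemma lax_milgram:
  fixes A :: "'b::{real_inner, complete_space} \<Rightarrow>\<^sub>L 'b"
  assumes "C > 0" and coercive: "\<And>z. A z \<bullet> z \<ge> C * (norm z)\<^sup>2"
  obtains I where "I o\<^sub>L A = id_blinfun" "A o\<^sub>L I = id_blinfun"
proof -
  \<comment> \<open>The summand \<open>C\<close> ensures \<open>0 < C \<le> K\<close> even on the zero space, where \<open>A = 0\<close> is coercive.\<close>
  define K where "K = norm A + C"
  define \<rho> where "\<rho> = C / K\<^sup>2"
  define q where "q = sqrt (1 - C\<^sup>2 / K\<^sup>2)"
  have K: "K > 0" "C \<le> K" using \<open>C > 0\<close> by (auto simp: K_def add_nonneg_pos)
  have \<rho>: "\<rho> > 0" using K \<open>C > 0\<close> by (simp add: \<rho>_def)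
  have le1: "C\<^sup>2 / K\<^sup>2 \<le> 1" "0 < C\<^sup>2 / K\<^sup>2"
    using K \<open>C > 0\<close> by (simp_all add: power_mono)
  have q: "0 \<le> q" "q < 1" "q\<^sup>2 = 1 - C\<^sup>2 / K\<^sup>2"
    using le1 by (auto simp: q_def)
  show ?thesis
  proof (rule inverse_of_approximate_inverse[of "\<rho> *\<^sub>R id_blinfun" q A])
    show "inj (\<rho> *\<^sub>R (id_blinfun :: 'b \<Rightarrow>\<^sub>L 'b))"
      using \<rho> by (auto simp: inj_def blinfun.scaleR_left)
    show "norm (z - (\<rho> *\<^sub>R id_blinfun) (A z)) \<le> q * norm z" for z
    proof (rule power2_le_imp_le)
      have "norm (A z) \<le> K * norm z"
        using norm_blinfun[of A z] \<open>C > 0\<close> unfolding K_def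
        by (meson add_increasing2 less_imp_le mult_right_mono norm_ge_zero order_refl order_trans)
      hence "(norm (A z))\<^sup>2 \<le> K\<^sup>2 * (norm z)\<^sup>2"
        by (metis norm_ge_zero power_mono power_mult_distrib)
      hence 1: "\<rho>\<^sup>2 * (norm (A z))\<^sup>2 \<le> \<rho>\<^sup>2 * (K\<^sup>2 * (norm z)\<^sup>2)"
        by (rule mult_left_mono) simp
      have 2: "\<rho> * (C * (norm z)\<^sup>2) \<le> \<rho> * (A z \<bullet> z)"
        using \<rho> coercive by (intro mult_left_mono) auto
      have "(norm (z - \<rho> *\<^sub>R A z))\<^sup>2 = (norm z)\<^sup>2 - 2 * (\<rho> * (A z \<bullet> z)) + \<rho>\<^sup>2 * (norm (A z))\<^sup>2"
        unfolding power2_norm_eq_inner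
        by (simp add: inner_diff inner_commute power2_eq_square algebra_simps)
      also have "\<dots> \<le> (norm z)\<^sup>2 - 2 * (\<rho> * (C * (norm z)\<^sup>2)) + \<rho>\<^sup>2 * (K\<^sup>2 * (norm z)\<^sup>2)"
        using 1 2 by linarith
      also have "\<dots> = (q * norm z)\<^sup>2"
        unfolding power_mult_distrib q(3) using K by (simp add: \<rho>_def field_simps power2_eq_square)
      finally show "(norm (z - (\<rho> *\<^sub>R id_blinfun) (A z)))\<^sup>2 \<le> (q * norm z)\<^sup>2"
        by (simp add: blinfun.scaleR_left)
    qed (use q in simp)
  qed (use q that in auto)
qed

section \<open>Implicit functions of class C2\<close>

lemma C2_on_subset:
  assumes C2: "C2_on UNIV W f" and T: "subspace T" "closed T"
    and D: "openin (top_of_set T) D" "D \<subseteq> W" and eq: "\<And>x. x \<in> D \<Longrightarrow> g x = f x"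
  shows "C2_on T D g"
proof -
  obtain f' f'' where f: "has_C2_derivs UNIV W f f' f''"
    using C2 unfolding C2_on_def by blast
  have "(f has_derivative f' u) (at u within D)" "(f' has_derivative f'' u) (at u within D)"
    if "u \<in> D" for u
    using f that D(2) unfolding has_C2_derivs_def by (meson has_derivative_subset subsetD)+
  moreover have "continuous_on D f''"
    using f D(2) unfolding has_C2_derivs_def by (meson continuous_on_subset)
  moreover have "(g has_derivative f' u) (at u within D)"
    if "u \<in> D" "(f has_derivative f' u) (at u within D)" for u
    using has_derivative_transform[of u D g f] that eq by auto
  ultimately have "has_C2_derivs T D g f' f''"
    using T D(1) unfolding has_C2_derivs_def by blast
  thus ?thesis unfolding C2_on_def by blast
qed

text \<open>
  The bound is required in the direction \<open>b - a\<close> only. For a map on a subspace, the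
  derivative is determined in tangential directions only, and so is any bound on it.
\<close>
lemma mean_value_bound_segment:
  fixes f :: "'a::real_normed_vector \<Rightarrow> 'b::real_normed_vector"
  assumes S: "convex S" "a \<in> S" "b \<in> S"
    and f: "\<And>u. u \<in> S \<Longrightarrow> (f has_derivative f' u) (at u within S)"
    and bound: "\<And>u. u \<in> S \<Longrightarrow> norm (f' u (b - a)) \<le> C"
  shows "norm (f b - f a) \<le> C"
proof -
  define \<gamma> where "\<gamma> t = a + t *\<^sub>R (b - a)" for t :: real
  have \<gamma>: "\<gamma> t \<in> S" if "t \<in> {0..1}" for t
  proof -
    have "\<gamma> t = (1 - t) *\<^sub>R a + t *\<^sub>R b" by (simp add: \<gamma>_def algebra_simps)
    thus ?thesis using S that by (auto intro: convexD_alt)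
  qed
  have "norm (f (\<gamma> 1) - f (\<gamma> 0)) \<le> C * norm (1 - 0 :: real)"
  proof (rule differentiable_bound[of "{0..1}" _ "\<lambda>t s. f' (\<gamma> t) (s *\<^sub>R (b - a))"])
    fix t :: real assume t: "t \<in> {0..1}"
    have "(\<gamma> has_derivative (\<lambda>s. s *\<^sub>R (b - a))) (at t within {0..1})"
      unfolding \<gamma>_def by (auto intro!: derivative_eq_intros)
    moreover have "(f has_derivative f' (\<gamma> t)) (at (\<gamma> t) within \<gamma> ` {0..1})"
      by (rule has_derivative_subset[OF f[OF \<gamma>[OF t]]]) (use \<gamma> in auto)
    ultimately show "((\<lambda>t. f (\<gamma> t)) has_derivative (\<lambda>s. f' (\<gamma> t) (s *\<^sub>R (b - a)))) (at t within {0..1})"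
      by (rule has_derivative_in_compose)
    have "linear (f' (\<gamma> t))" using f[OF \<gamma>[OF t]] by (rule has_derivative_linear)
    hence "norm (f' (\<gamma> t) (s *\<^sub>R (b - a))) \<le> C * norm s" for s
      using mult_left_mono[OF bound[OF \<gamma>[OF t]], of "\<bar>s\<bar>"]
      by (simp add: linear_scale mult.commute)
    thus "onorm (\<lambda>s. f' (\<gamma> t) (s *\<^sub>R (b - a))) \<le> C"
      by (rule onorm_le)
  qed auto
  thus ?thesis by (simp add: \<gamma>_def)
qed

text \<open>
  Where one factor vanishes, the product rule needs only continuity of the other: replacing
  \<open>g z\<close> by \<open>g x\<close> changes the product by \<open>O(\<parallel>z - x\<parallel>) o(1)\<close>.
\<close>
lemma (in bounded_bilinear) has_derivative_prod_vanishing: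
  assumes f: "(f has_derivative f') (at x)" "f x = 0" and g: "continuous (at x) g"
  shows "((\<lambda>z. prod (f z) (g z)) has_derivative (\<lambda>h. prod (f' h) (g x))) (at x)"
proof -
  have "((\<lambda>z. prod (f z) (g x)) has_derivative (\<lambda>h. prod (f' h) (g x))) (at x)"
    by (rule bounded_linear.has_derivative[OF bounded_linear_left f(1)])
  moreover have "((\<lambda>z. prod (f z) (g z - g x)) has_derivative (\<lambda>h. 0)) (at x)"
    unfolding has_derivative_within_alt
  proof (intro conjI allI impI)
    fix e :: real assume "e > 0"
    obtain K where K: "K > 0" "\<And>a b. norm (prod a b) \<le> norm a * norm b * K"
      using pos_bounded by auto
    obtain L where L: "L > 0" "\<And>h. norm (f' h) \<le> norm h * L"
      using bounded_linear.pos_bounded[OF has_derivative_bounded_linear[OF f(1)]] by auto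
    obtain d1 where d1: "d1 > 0" "\<And>z. norm (z - x) < d1 \<Longrightarrow> norm (f z - f' (z - x)) \<le> norm (z - x)"
      using f unfolding has_derivative_within_alt by (auto dest: spec[of _ 1])
    define e' where "e' = e / ((1 + L) * K)"
    have e': "e' > 0" using \<open>e > 0\<close> K L by (simp add: e'_def)
    then obtain d2 where d2: "d2 > 0" "\<And>z. norm (z - x) < d2 \<Longrightarrow> norm (g z - g x) < e'"
      using g unfolding continuous_at_eps_delta dist_norm by blast
    have "norm (prod (f z) (g z - g x)) \<le> e * norm (z - x)" if "norm (z - x) < min d1 d2" for z
    proof -
      have "norm (f z) \<le> norm (f z - f' (z - x)) + norm (f' (z - x))"
        by (metis diff_add_cancel norm_triangle_ineq)
      also have "\<dots> \<le> (1 + L) * norm (z - x)"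
        using d1(2)[of z] L(2)[of "z - x"] that by (simp add: algebra_simps)
      finally have "norm (f z) * norm (g z - g x) * K \<le> ((1 + L) * norm (z - x)) * e' * K"
        using d2(2)[of z] that K L by (intro mult_right_mono mult_mono) auto
      also have "\<dots> = e * norm (z - x)"
        using K L by (simp add: e'_def)
      finally show ?thesis using K(2) order_trans by blast
    qed
    thus "\<exists>d>0. \<forall>y\<in>UNIV. norm (y - x) < d \<longrightarrow>
        norm (prod (f y) (g y - g x) - prod (f x) (g x - g x) - 0) \<le> e * norm (y - x)"
      using d1(1) d2(1) by (intro exI[of _ "min d1 d2"]) (auto simp: zero_right)
  qed simp
  ultimately have "((\<lambda>z. prod (f z) (g x) + prod (f z) (g z - g x)) has_derivative
      (\<lambda>h. prod (f' h) (g x) + 0)) (at x)"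
    by (rule has_derivative_add)
  thus ?thesis by (simp add: diff_right)
qed

interpretation blinfun_compose: bounded_bilinear "(o\<^sub>L)"
  by (rule bounded_bilinear_blinfun_compose)

text \<open>
  The identity behind both continuity and differentiability of the solution \<open>G\<close> of a linear
  equation \<open>A G = N\<close> whose data vary: the increment of \<open>G\<close> is the solution for the increments of
  the data.
\<close>
lemma solution_difference:
  assumes "Az o\<^sub>L Gz = Nz" "Aw o\<^sub>L Gw = Nw" "Sw o\<^sub>L Aw = id_blinfun"
  shows "Gz - Gw = Sw o\<^sub>L ((Nz - Nw) - ((Az - Aw) o\<^sub>L Gz))"
proof (rule blinfun_eqI)
  fix h
  have "Az (Gz h) = Nz h" "\<And>y. Sw (Aw y) = y" "Sw (Nw h) = Gw h"
    using assms by (metis blinfun_apply_blinfun_compose blinfun_apply_id_blinfun)+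
  thus "(Gz - Gw) h = (Sw o\<^sub>L ((Nz - Nw) - ((Az - Aw) o\<^sub>L Gz))) h"
    by (simp add: blinfun.diff_left blinfun.diff_right)
qed

lemma continuous_on_linear_solution:
  assumes eq: "\<And>w. w \<in> W \<Longrightarrow> A w o\<^sub>L G w = N w"
    and S: "\<And>w. w \<in> W \<Longrightarrow> S w o\<^sub>L A w = id_blinfun" "\<And>w. w \<in> W \<Longrightarrow> norm (S w) \<le> K"
    and A: "continuous_on W A" and N: "continuous_on W N"
  shows "continuous_on W G"
  unfolding continuous_on_def
proof
  fix w assume w: "w \<in> W"
  have "((\<lambda>z. G z - G w) \<longlongrightarrow> 0) (at w within W)"
  proof (rule Lim_null_comparison)
    show "\<forall>\<^sub>F z in at w within W. norm (G z - G w) \<le> K * norm ((N z - N w) - ((A z - A w) o\<^sub>L G w))"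
    proof -
      have "norm (G z - G w) \<le> K * norm ((N z - N w) - ((A z - A w) o\<^sub>L G w))" if z: "z \<in> W" for z
      proof -
        \<comment> \<open>The roles are exchanged so that the varying solution \<open>G z\<close> is absent from the right side and the uniform bound on \<open>S z\<close> applies.\<close>
        have "G w - G z = S z o\<^sub>L ((N w - N z) - ((A w - A z) o\<^sub>L G w))"
          by (rule solution_difference[OF eq[OF w] eq[OF z] S(1)[OF z]])
        also have "(N w - N z) - ((A w - A z) o\<^sub>L G w) = - ((N z - N w) - ((A z - A w) o\<^sub>L G w))"
          by (simp add: blinfun_compose.diff_left)
        finally have "norm (G w - G z) \<le> norm (S z) * norm ((N z - N w) - ((A z - A w) o\<^sub>L G w))"
          by (metis norm_blinfun_compose norm_minus_cancel)
        also have "\<dots> \<le> K * norm ((N z - N w) - ((A z - A w) o\<^sub>L G w))"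
          by (rule mult_right_mono[OF S(2)[OF z]]) simp
        finally show ?thesis by (simp add: norm_minus_commute)
      qed
      thus ?thesis by (auto simp: eventually_at_filter)
    qed
    have "((\<lambda>z. K * norm ((N z - N w) - ((A z - A w) o\<^sub>L G w))) \<longlongrightarrow>
        K * norm ((N w - N w) - ((A w - A w) o\<^sub>L G w))) (at w within W)"
      using A N w unfolding continuous_on_def by (intro tendsto_intros) auto
    thus "((\<lambda>z. K * norm ((N z - N w) - ((A z - A w) o\<^sub>L G w))) \<longlongrightarrow> 0) (at w within W)" by simp
  qed
  thus "(G \<longlongrightarrow> G w) (at w within W)" by (simp add: LIM_zero_iff)
qed

text \<open>
  In \<open>solution_difference\<close> the factor \<open>A z - A w\<close> vanishes at \<open>w\<close>, so continuity of \<open>G\<close> is enough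
  to differentiate its product with \<open>G z\<close>.
\<close>
lemma has_derivative_linear_solution:
  assumes W: "open W" "w \<in> W"
    and eq: "\<And>w. w \<in> W \<Longrightarrow> A w o\<^sub>L G w = N w" and S: "S o\<^sub>L A w = id_blinfun"
    and A: "(A has_derivative A') (at w)" and N: "(N has_derivative N') (at w)"
    and G: "continuous_on W G"
  shows "(G has_derivative (\<lambda>h. S o\<^sub>L (N' h - (A' h o\<^sub>L G w)))) (at w)"
proof -
  have "((\<lambda>z. (A z - A w) o\<^sub>L G z) has_derivative (\<lambda>h. A' h o\<^sub>L G w)) (at w)"
    by (rule blinfun_compose.has_derivative_prod_vanishing)
      (use A W G in \<open>auto intro!: derivative_eq_intros simp: continuous_on_eq_continuous_at\<close>)
  moreover have "((\<lambda>z. N z - N w) has_derivative N') (at w)"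
    using N by (auto intro!: derivative_eq_intros)
  ultimately have "((\<lambda>z. (N z - N w) - ((A z - A w) o\<^sub>L G z)) has_derivative
      (\<lambda>h. N' h - (A' h o\<^sub>L G w))) (at w)"
    by (intro has_derivative_diff)
  hence "((\<lambda>z. S o\<^sub>L ((N z - N w) - ((A z - A w) o\<^sub>L G z))) has_derivative
      (\<lambda>h. S o\<^sub>L (N' h - (A' h o\<^sub>L G w)))) (at w)"
    by (rule bounded_linear.has_derivative[OF blinfun_compose.bounded_linear_right])
  from has_derivative_add[OF has_derivative_const[of "G w"] this]
  have "((\<lambda>z. G w + (S o\<^sub>L ((N z - N w) - ((A z - A w) o\<^sub>L G z)))) has_derivative
      (\<lambda>h. S o\<^sub>L (N' h - (A' h o\<^sub>L G w)))) (at w)"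
    by simp
  thus ?thesis
  proof (rule has_derivative_transform_within_open[OF _ W])
    fix z assume "z \<in> W"
    thus "G w + (S o\<^sub>L ((N z - N w) - ((A z - A w) o\<^sub>L G z))) = G z"
      using solution_difference[OF eq[of z] eq[OF W(2)] S] by (simp add: algebra_simps)
  qed
qed

text \<open>
  The Lipschitz bound makes the remainder of \<open>F\<close> along \<open>u z = z - J (d z)\<close> an \<open>o(\<parallel>z - w\<parallel>)\<close>. Since
  \<open>F\<close> is constant along \<open>u\<close>, this remainder is \<open>- F' (u z - u w)\<close>, and applying \<open>S\<close> solves for the
  increment of \<open>d\<close>.
\<close>
lemma has_derivative_implicit:
  fixes J :: "'b::real_normed_vector \<Rightarrow>\<^sub>L 'a::real_normed_vector" and F' :: "'a \<Rightarrow>\<^sub>L 'c::real_normed_vector"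
  assumes W: "open W" "w \<in> W"
    and eq: "\<And>z. z \<in> W \<Longrightarrow> F (z - J (d z)) = c"
    and F: "(F has_derivative F') (at (w - J (d w)))"
    and S: "S o\<^sub>L (F' o\<^sub>L J) = id_blinfun"
    and lipschitz: "\<And>z. z \<in> W \<Longrightarrow> norm (d z - d w) \<le> C * norm (z - w)"
  shows "(d has_derivative (S o\<^sub>L F')) (at w)"
  unfolding has_derivative_within_alt
proof (intro conjI allI impI)
  fix e :: real assume "e > 0"
  define M where "M = 1 + norm J * \<bar>C\<bar>"
  have M: "M > 0" by (simp add: M_def add_pos_nonneg)
  define e' where "e' = e / ((norm S + 1) * M)"
  have e': "e' > 0" using \<open>e > 0\<close> M by (simp add: e'_def add_nonneg_pos)
  define u where "u z = z - J (d z)" for z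
  obtain \<delta> where \<delta>: "\<delta> > 0"
    "\<And>y. norm (y - u w) < \<delta> \<Longrightarrow> norm (F y - F (u w) - F' (y - u w)) \<le> e' * norm (y - u w)"
    using F e' unfolding has_derivative_within_alt u_def by blast
  obtain \<rho> where \<rho>: "\<rho> > 0" "\<And>z. norm (z - w) < \<rho> \<Longrightarrow> z \<in> W"
    using W unfolding open_dist dist_norm by blast
  have "norm (d z - d w - (S o\<^sub>L F') (z - w)) \<le> e * norm (z - w)"
    if "norm (z - w) < min \<rho> (\<delta> / M)" for z
  proof -
    have z: "z \<in> W" "norm (z - w) * M < \<delta>"
      using that \<rho> M by (auto simp: field_simps)
    have "norm (u z - u w) = norm ((z - w) - J (d z - d w))"
      by (simp add: u_def blinfun.diff_right algebra_simps)
    also have "\<dots> \<le> norm (z - w) + norm (J (d z - d w))" by (rule norm_triangle_ineq4)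
    also have "norm (J (d z - d w)) \<le> norm J * (\<bar>C\<bar> * norm (z - w))"
    proof -
      have "norm (d z - d w) \<le> \<bar>C\<bar> * norm (z - w)"
        using lipschitz[OF z(1)] by (meson abs_ge_self mult_right_mono norm_ge_zero order_trans)
      thus ?thesis using norm_blinfun[of J "d z - d w"] mult_left_mono[of _ _ "norm J"]
        by (meson norm_ge_zero order_trans)
    qed
    finally have u: "norm (u z - u w) \<le> M * norm (z - w)" by (simp add: M_def algebra_simps)
    have "F (u z) = c" "F (u w) = c" using eq z W(2) by (auto simp: u_def)
    hence "norm (F' (u z - u w)) \<le> e' * norm (u z - u w)"
      using \<delta>(2)[of "u z"] u z by (simp add: mult.commute)
    also have "\<dots> \<le> e' * (M * norm (z - w))" using u e' by (intro mult_left_mono) auto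
    finally have small: "norm (F' (u z - u w)) \<le> e' * (M * norm (z - w))" .
    have SJ: "S (F' (J y)) = y" for y
      using S by (metis blinfun_apply_blinfun_compose blinfun_apply_id_blinfun)
    have "d z - d w - (S o\<^sub>L F') (z - w) = - S (F' (u z - u w))"
      by (simp add: u_def blinfun.diff_right SJ)
    hence "norm (d z - d w - (S o\<^sub>L F') (z - w)) \<le> norm S * norm (F' (u z - u w))"
      by (simp add: norm_blinfun)
    also have "\<dots> \<le> (norm S + 1) * (e' * (M * norm (z - w)))"
      using small by (intro mult_mono) auto
    also have "\<dots> = e * norm (z - w)"
    proof -
      have "norm S + 1 \<noteq> 0" using norm_ge_zero[of S] by linarith
      thus ?thesis using M by (simp add: e'_def)
    qed
    finally show ?thesis .
  qed
  thus "\<exists>\<eta>>0. \<forall>z\<in>UNIV. norm (z - w) < \<eta> \<longrightarrow>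
      norm (d z - d w - (S o\<^sub>L F') (z - w)) \<le> e * norm (z - w)"
    using \<rho>(1) \<delta>(1) M by (intro exI[of _ "min \<rho> (\<delta> / M)"]) auto
qed (rule blinfun.bounded_linear_right)

text \<open>
  Implicit function theorem for an already known Lipschitz solution. The first derivative of \<open>d\<close>
  is the solution \<open>d' w\<close> of a linear equation whose operator \<open>A w\<close> and right side \<open>N w\<close> are
  differentiable in \<open>w\<close>, so it is differentiable too, and its derivative is an explicit
  continuous expression in \<open>S\<close>, \<open>d'\<close> and \<open>N'\<close>.
\<close>
theorem implicit_C2:
  fixes F :: "'a::{real_inner, complete_space} \<Rightarrow> 'c::real_normed_vector"
    and J :: "'b::real_normed_vector \<Rightarrow>\<^sub>L 'a"
  assumes W: "open W"
    and F: "has_C2_derivs UNIV UNIV F F' F''"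
    and eq: "\<And>w. w \<in> W \<Longrightarrow> F (w - J (d w)) = c"
    and lipschitz: "\<And>w z. w \<in> W \<Longrightarrow> z \<in> W \<Longrightarrow> norm (d z - d w) \<le> C * norm (z - w)"
    and S: "\<And>w. w \<in> W \<Longrightarrow> S w o\<^sub>L (F' (w - J (d w)) o\<^sub>L J) = id_blinfun"
      "\<And>w. w \<in> W \<Longrightarrow> (F' (w - J (d w)) o\<^sub>L J) o\<^sub>L S w = id_blinfun"
    and S_bound: "\<And>w. w \<in> W \<Longrightarrow> norm (S w) \<le> K"
  shows "C2_on UNIV W d"
proof -
  define u where "u w = w - J (d w)" for w
  define N where "N w = F' (u w)" for w
  define A where "A w = N w o\<^sub>L J" for w
  define d' where "d' w = S w o\<^sub>L N w" for w
  define u' where "u' w = id_blinfun - (J o\<^sub>L d' w)" for w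
  define N' where "N' w = F'' (u w) o\<^sub>L u' w" for w
  \<comment> \<open>The Leibniz rule for \<open>A w o\<^sub>L d' w = N w\<close>, solved for the derivative of \<open>d'\<close>: in direction \<open>h\<close> this is \<open>S w o\<^sub>L (N' w h - (N' w h o\<^sub>L J) o\<^sub>L d' w)\<close>.\<close>
  define d'' where "d'' w = blinfun_compose.prod_right (S w) o\<^sub>L
      (N' w - (blinfun_compose.prod_left (d' w) o\<^sub>L (blinfun_compose.prod_left J o\<^sub>L N' w)))" for w
  have F1: "(F has_derivative F' w) (at w)" and F2: "(F' has_derivative F'' w) (at w)" for w
    using F unfolding has_C2_derivs_def by auto
  have F3: "continuous_on UNIV F''"
    using F unfolding has_C2_derivs_def by auto
  have AS: "S w o\<^sub>L A w = id_blinfun" "A w o\<^sub>L S w = id_blinfun" if "w \<in> W" for w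
    using S[OF that] by (simp_all add: A_def N_def u_def)
  have d: "(d has_derivative d' w) (at w)" if w: "w \<in> W" for w
  proof -
    have Fw: "(F has_derivative N w) (at (w - J (d w)))"
      using F1 by (simp add: N_def u_def)
    have Sw: "S w o\<^sub>L (N w o\<^sub>L J) = id_blinfun"
      using AS(1)[OF w] by (simp add: A_def)
    show ?thesis
      unfolding d'_def
      by (rule has_derivative_implicit[where F = F and J = J and d = d and c = c and C = C,
            OF W w eq Fw Sw lipschitz[OF w]])
  qed
  have u: "(u has_derivative u' w) (at w)" if "w \<in> W" for w
  proof -
    have "((\<lambda>w. J (d w)) has_derivative (\<lambda>h. J (d' w h))) (at w)"
      by (rule bounded_linear.has_derivative[OF blinfun.bounded_linear_right d[OF that]])
    hence "(u has_derivative (\<lambda>h. h - J (d' w h))) (at w)"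
      unfolding u_def[abs_def] by (intro has_derivative_diff has_derivative_ident)
    moreover have "blinfun_apply (u' w) = (\<lambda>h. h - J (d' w h))" by (auto simp: u'_def blinfun.diff_left)
    ultimately show ?thesis by simp
  qed
  have N: "(N has_derivative N' w) (at w)" if "w \<in> W" for w
  proof -
    have "blinfun_apply (N' w) = (\<lambda>h. F'' (u w) (u' w h))" by (auto simp: N'_def)
    thus ?thesis
      using has_derivative_compose[OF u[OF that] F2[of "u w"]] unfolding N_def[abs_def] by metis
  qed
  have A: "(A has_derivative (\<lambda>h. N' w h o\<^sub>L J)) (at w)" if "w \<in> W" for w
    unfolding A_def[abs_def]
    by (rule bounded_linear.has_derivative[OF blinfun_compose.bounded_linear_left N[OF that]])
  have cont_u: "continuous_on W u"
    by (rule has_derivative_continuous_on) (use u has_derivative_at_withinI in blast)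
  have cont_N: "continuous_on W N"
    by (rule has_derivative_continuous_on) (use N has_derivative_at_withinI in blast)
  have cont_A: "continuous_on W A"
    unfolding A_def[abs_def] by (intro continuous_intros cont_N)
  have d'_eq: "A w o\<^sub>L d' w = N w" if "w \<in> W" for w
  proof -
    have "A w o\<^sub>L d' w = (A w o\<^sub>L S w) o\<^sub>L N w" by (rule blinfun_eqI) (simp add: d'_def)
    also have "\<dots> = N w" unfolding AS(2)[OF that] by (rule blinfun_eqI) simp
    finally show ?thesis .
  qed
  have cont_d': "continuous_on W d'"
    by (rule continuous_on_linear_solution[OF d'_eq AS(1) S_bound cont_A cont_N])
  have cont_S: "continuous_on W S"
    by (rule continuous_on_linear_solution[OF AS(2) AS(1) S_bound cont_A continuous_on_const])
  have d2: "(d' has_derivative d'' w) (at w)" if "w \<in> W" for w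
  proof -
    have "(d' has_derivative (\<lambda>h. S w o\<^sub>L (N' w h - ((N' w h o\<^sub>L J) o\<^sub>L d' w)))) (at w)"
      by (rule has_derivative_linear_solution[OF W that d'_eq AS(1)[OF that] A[OF that] N[OF that] cont_d'])
    moreover have "blinfun_apply (d'' w) = (\<lambda>h. S w o\<^sub>L (N' w h - ((N' w h o\<^sub>L J) o\<^sub>L d' w)))"
      by (auto simp: d''_def blinfun.diff_left)
    ultimately show ?thesis by simp
  qed
  have cont_N': "continuous_on W N'"
  proof -
    have "continuous_on W (\<lambda>w. F'' (u w))"
      by (rule continuous_on_compose2[OF F3 cont_u]) auto
    moreover have "continuous_on W u'"
      unfolding u'_def[abs_def] by (intro continuous_intros cont_d')
    ultimately show ?thesis unfolding N'_def[abs_def] by (intro continuous_intros)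
  qed
  have "continuous_on W d''"
    unfolding d''_def[abs_def]
    by (intro continuous_intros cont_N'
        bounded_linear.continuous_on[OF blinfun_compose.bounded_linear_prod_right cont_S]
        bounded_linear.continuous_on[OF blinfun_compose.bounded_linear_prod_left cont_d'])
  hence "has_C2_derivs UNIV W d d' d''"
    unfolding has_C2_derivs_def using W d d2 by (simp add: has_derivative_at_withinI)
  thus ?thesis unfolding C2_on_def by blast
qed

section \<open>Solving the constraint along a retraction\<close>

text \<open>
  Precomposition with a bounded operator into \<open>T\<close> makes a \<open>C\<^sup>2\<close> map on the subspace \<open>T\<close> a \<open>C\<^sup>2\<close> map
  on the whole space. For a projection onto \<open>T\<close> it is an extension.
\<close>
lemma has_C2_derivs_compose_projection:
  fixes Q :: "'a::{real_inner, complete_space} \<Rightarrow>\<^sub>L 'a"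
  assumes f: "has_C2_derivs T T f f' f''" and Q: "\<And>w. Q w \<in> T"
  shows "has_C2_derivs UNIV UNIV (\<lambda>w. f (Q w)) (\<lambda>w. f' (Q w) o\<^sub>L Q)
    (\<lambda>w. blinfun_compose.prod_left Q o\<^sub>L (f'' (Q w) o\<^sub>L Q))"
proof -
  have Qd: "(blinfun_apply Q has_derivative blinfun_apply Q) (at w)" for w
    by (rule bounded_linear_imp_has_derivative) (rule blinfun.bounded_linear_right)
  have f1: "(f has_derivative f' u) (at u within range Q)"
    and f2: "(f' has_derivative f'' u) (at u within range Q)" if "u \<in> T" for u
    using f that Q unfolding has_C2_derivs_def by (meson has_derivative_subset image_subsetI)+
  have 1: "((\<lambda>w. f (Q w)) has_derivative (f' (Q w) o\<^sub>L Q)) (at w)" for w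
    using has_derivative_in_compose[OF Qd f1[OF Q]] by (simp add: o_def blinfun_compose.rep_eq)
  have "((\<lambda>w. f' (Q w)) has_derivative (\<lambda>h. f'' (Q w) (Q h))) (at w)" for w
    using has_derivative_in_compose[OF Qd f2[OF Q]] by simp
  hence "((\<lambda>w. f' (Q w) o\<^sub>L Q) has_derivative (\<lambda>h. f'' (Q w) (Q h) o\<^sub>L Q)) (at w)" for w
    by (rule bounded_linear.has_derivative[OF blinfun_compose.bounded_linear_left])
  moreover have "blinfun_apply (blinfun_compose.prod_left Q o\<^sub>L (f'' (Q w) o\<^sub>L Q)) = (\<lambda>h. f'' (Q w) (Q h) o\<^sub>L Q)" for w
    by auto
  ultimately have 2: "((\<lambda>w. f' (Q w) o\<^sub>L Q) has_derivative
      (blinfun_compose.prod_left Q o\<^sub>L (f'' (Q w) o\<^sub>L Q))) (at w)" for w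
    by simp
  have "continuous_on T f''" using f unfolding has_C2_derivs_def by blast
  hence "continuous_on UNIV (\<lambda>w. f'' (Q w))"
    by (rule continuous_on_compose2) (use Q in \<open>auto intro: continuous_intros\<close>)
  thus ?thesis
    using 1 2 unfolding has_C2_derivs_def
    by (auto intro!: continuous_intros has_derivative_at_withinI)
qed

lemma has_C2_derivs_blinfun_compose:
  assumes f: "has_C2_derivs UNIV UNIV f f' f''"
  shows "has_C2_derivs UNIV UNIV (\<lambda>w. blinfun_apply B (f w)) (\<lambda>w. B o\<^sub>L f' w)
    (\<lambda>w. blinfun_compose.prod_right B o\<^sub>L f'' w)"
proof -
  have f1: "(f has_derivative f' w) (at w)" and f2: "(f' has_derivative f'' w) (at w)" for w
    using f unfolding has_C2_derivs_def by auto
  have f3: "continuous_on UNIV f''" using f unfolding has_C2_derivs_def by blast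
  have "((\<lambda>w. B (f w)) has_derivative (B o\<^sub>L f' w)) (at w)" for w
    using bounded_linear.has_derivative[OF blinfun.bounded_linear_right f1]
    by (simp add: o_def blinfun_compose.rep_eq)
  moreover have "((\<lambda>w. B o\<^sub>L f' w) has_derivative (blinfun_compose.prod_right B o\<^sub>L f'' w)) (at w)" for w
    using bounded_linear.has_derivative[OF blinfun_compose.bounded_linear_right f2, of B]
    by (simp add: blinfun_compose.rep_eq o_def)
  ultimately show ?thesis
    using f3 unfolding has_C2_derivs_def by (auto intro!: continuous_intros has_derivative_at_withinI)
qed

text \<open>
  The data at one base point: \<open>T\<close> is the tangent space, \<open>Q\<close> the projection onto it, \<open>J\<close> the
  adjoint of \<open>B\<close>, \<open>I\<close> the inverse of \<open>B Q J\<close>, and \<open>R\<close> the retraction at the base point \<open>R 0\<close>.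
\<close>
locale constrained_retraction =
  fixes T :: "'e::{real_inner, complete_space} set"
    and Q :: "'e \<Rightarrow>\<^sub>L 'e"
    and B :: "'e \<Rightarrow>\<^sub>L 'y::{real_inner, complete_space}"
    and J :: "'y \<Rightarrow>\<^sub>L 'e"
    and I :: "'y \<Rightarrow>\<^sub>L 'y"
    and c :: 'y
    and R :: "'e \<Rightarrow> 'e"
    and DR :: "'e \<Rightarrow> 'e \<Rightarrow>\<^sub>L 'e"
    and D2R :: "'e \<Rightarrow> 'e \<Rightarrow>\<^sub>L 'e \<Rightarrow>\<^sub>L 'e"
    and KP KL \<sigma> K1 K2 r \<Delta> :: real
  assumes R_C2: "has_C2_derivs T T R DR D2R"
    and Q_in: "\<And>w. Q w \<in> T" and Q_id: "\<And>v. v \<in> T \<Longrightarrow> Q v = v"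
    and DR_zero: "\<And>v. v \<in> T \<Longrightarrow> DR 0 v = v"
    and feasible: "B (R 0) = c"
    and I_left: "\<And>y. I (B (Q (J y))) = y" and I_inj: "inj I"
    and norm_Q: "norm Q \<le> KP" and norm_J: "norm J \<le> norm B" and norm_I: "norm I \<le> KL"
    and pos: "0 < KP" "0 < KL" "0 < norm B" "0 < \<sigma>" "0 < K1" "0 < K2"
    and DR_bound: "\<And>u v. u \<in> T \<Longrightarrow> norm u \<le> \<sigma> \<Longrightarrow> v \<in> T \<Longrightarrow> norm (DR u v) \<le> K1 * norm v"
    and D2R_bound: "\<And>u v w. u \<in> T \<Longrightarrow> norm u \<le> \<sigma> \<Longrightarrow> v \<in> T \<Longrightarrow> w \<in> T \<Longrightarrow>
          norm (D2R u v w) \<le> K2 * norm v * norm w"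
    and r: "r = min (\<sigma> / (2 * KP * norm B)) (1 / (4 * K2 * KL * KP\<^sup>2 * norm B ^ 3))"
    and \<Delta>: "\<Delta> = min (\<sigma> / 2)
              (min (1 / (4 * K2 * KL * KP * (norm B)\<^sup>2)) (r / (2 * K1 * KL * norm B)))"
begin

text \<open>
  A bound for \<open>v - Q (J \<delta>)\<close> with \<open>\<parallel>v\<parallel> < \<Delta>\<close> and \<open>\<parallel>\<delta>\<parallel> \<le> r\<close>: all points at which \<open>R\<close> is evaluated.
\<close>
definition \<rho> :: real where "\<rho> = \<Delta> + KP * (norm B * r)"

lemma r_pos: "0 < r" and \<Delta>_pos: "0 < \<Delta>"
  using pos by (auto simp: r \<Delta>)

text \<open>
  The two minima that define \<open>r\<close> and \<open>\<Delta>\<close> are balanced: their first entries contribute \<open>\<sigma>/2\<close> each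
  to \<open>\<rho>\<close>, and their second entries contribute \<open>1/4\<close> each to the contraction factor.
\<close>
lemma \<rho>_bounds: "0 \<le> \<rho>" "\<rho> \<le> \<sigma>" "KL * (norm B * (K2 * \<rho> * (KP * norm B))) \<le> 1 / 2"
proof -
  show "0 \<le> \<rho>" using r_pos \<Delta>_pos pos by (simp add: \<rho>_def)
  have "KP * (norm B * r) \<le> KP * (norm B * (\<sigma> / (2 * KP * norm B)))"
    using pos by (intro mult_left_mono) (auto simp: r)
  also have "\<dots> = \<sigma> / 2" using pos by simp
  finally show "\<rho> \<le> \<sigma>" unfolding \<rho>_def using \<Delta> by linarith
  define k where "k = KL * norm B * K2 * KP * norm B"
  have k: "k > 0" using pos by (simp add: k_def)
  have "k * \<Delta> \<le> k * (1 / (4 * K2 * KL * KP * (norm B)\<^sup>2))"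
    using k by (intro mult_left_mono) (auto simp: \<Delta>)
  also have "\<dots> = 1 / 4" using pos by (simp add: k_def power2_eq_square)
  finally have 1: "k * \<Delta> \<le> 1 / 4" .
  have "k * (KP * (norm B * r)) \<le> k * (KP * (norm B * (1 / (4 * K2 * KL * KP\<^sup>2 * norm B ^ 3))))"
    using k pos by (intro mult_left_mono) (auto simp: r)
  also have "\<dots> = 1 / 4" using pos by (simp add: k_def power2_eq_square power3_eq_cube)
  finally have "k * \<rho> \<le> 1 / 2" using 1 by (simp add: \<rho>_def algebra_simps)
  thus "KL * (norm B * (K2 * \<rho> * (KP * norm B))) \<le> 1 / 2"
    by (simp add: k_def algebra_simps)
qed

text \<open>
  The last entry of the minimum \<open>\<Delta>\<close>: the first Newton step from \<open>0\<close> covers at most half the radius.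
\<close>
lemma displacement_bound: "KL * (norm B * (K1 * \<Delta>)) \<le> r / 2"
proof -
  have "KL * (norm B * (K1 * \<Delta>)) \<le> KL * (norm B * (K1 * (r / (2 * K1 * KL * norm B))))"
    using pos by (intro mult_left_mono) (auto simp: \<Delta>)
  also have "\<dots> = r / 2" using pos by simp
  finally show ?thesis .
qed

lemma T: "subspace T" "closed T"
  using R_C2 by (auto simp: has_C2_derivs_def)

lemma convex_T_ball: "convex (T \<inter> cball 0 s)"
  by (intro convex_Int convex_cball subspace_imp_convex T)

lemma R_deriv: "u \<in> T \<Longrightarrow> (R has_derivative DR u) (at u within T \<inter> S)"
  and DR_deriv: "u \<in> T \<Longrightarrow> (DR has_derivative D2R u) (at u within T \<inter> S)"
  using R_C2 unfolding has_C2_derivs_def by (meson has_derivative_subset inf_le1)+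

lemma norm_IB_le: "norm (I (B w)) \<le> KL * (norm B * norm w)"
proof -
  have "norm (I (B w)) \<le> norm I * norm (B w)" by (rule norm_blinfun)
  also have "\<dots> \<le> KL * (norm B * norm w)"
    using norm_I pos by (intro mult_mono norm_blinfun) auto
  finally show ?thesis .
qed

lemma norm_Q_le: "norm (Q w) \<le> KP * norm w"
  using norm_blinfun[of Q w] norm_Q by (meson mult_right_mono norm_ge_zero order_trans)

lemma norm_QJ_le: "norm (Q (J y)) \<le> KP * (norm B * norm y)"
proof -
  have "norm (J y) \<le> norm B * norm y"
    using norm_blinfun[of J y] norm_J by (meson mult_right_mono norm_ge_zero order_trans)
  thus ?thesis using norm_Q_le[of "J y"] pos by (meson less_imp_le mult_left_mono order_trans)
qed

lemma R_lipschitz: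
  assumes "a \<in> T" "b \<in> T" "norm a \<le> \<sigma>" "norm b \<le> \<sigma>"
  shows "norm (R b - R a) \<le> K1 * norm (b - a)"
  by (rule mean_value_bound_segment[OF convex_T_ball[of \<sigma>], where f' = DR])
    (use assms R_deriv DR_bound subspace_diff[OF T(1)] in auto)

lemma DR_near_identity:
  assumes "u \<in> T" "norm u \<le> \<sigma>" "h \<in> T"
  shows "norm (DR u h - h) \<le> K2 * norm u * norm h"
proof -
  have "norm (DR u h - DR 0 h) \<le> K2 * norm u * norm h"
  proof (rule mean_value_bound_segment[OF convex_T_ball[of \<sigma>], where a = 0 and b = u
          and f = "\<lambda>u. DR u h" and f' = "\<lambda>v k. D2R v k h"])
    fix v assume "v \<in> T \<inter> cball 0 \<sigma>"
    thus "((\<lambda>u. DR u h) has_derivative (\<lambda>k. D2R v k h)) (at v within T \<inter> cball 0 \<sigma>)"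
      by (intro bounded_linear.has_derivative[OF blinfun.bounded_linear_left] DR_deriv) auto
    show "norm (D2R v (u - 0) h) \<le> K2 * norm u * norm h"
      using D2R_bound[of v u h] \<open>v \<in> _\<close> assms by auto
  qed (use assms T pos in \<open>auto intro: subspace_0\<close>)
  thus ?thesis using DR_zero assms by simp
qed

lemma R_near_identity:
  assumes "a \<in> T" "b \<in> T" "norm a \<le> \<rho>" "norm b \<le> \<rho>"
  shows "norm (R b - R a - (b - a)) \<le> K2 * \<rho> * norm (b - a)"
proof -
  have "norm ((R b - b) - (R a - a)) \<le> K2 * \<rho> * norm (b - a)"
  proof (rule mean_value_bound_segment[OF convex_T_ball[of \<rho>], where a = a and b = b
          and f = "\<lambda>u. R u - u" and f' = "\<lambda>u h. DR u h - h"])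
    fix u assume u: "u \<in> T \<inter> cball 0 \<rho>"
    thus "((\<lambda>u. R u - u) has_derivative (\<lambda>h. DR u h - h)) (at u within T \<inter> cball 0 \<rho>)"
      by (intro has_derivative_diff has_derivative_ident R_deriv) auto
    have "norm (DR u (b - a) - (b - a)) \<le> K2 * norm u * norm (b - a)"
      using u \<rho>_bounds assms subspace_diff[OF T(1)] by (intro DR_near_identity) auto
    also have "\<dots> \<le> K2 * \<rho> * norm (b - a)"
      using u pos by (intro mult_right_mono mult_left_mono) auto
    finally show "norm (DR u (b - a) - (b - a)) \<le> K2 * \<rho> * norm (b - a)" .
  qed (use assms in auto)
  thus ?thesis by (simp add: algebra_simps)
qed

text \<open>
  The solution map lives on an open set of the ambient space that meets \<open>T\<close> in its ball of
  radius \<open>\<Delta>\<close>.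
\<close>
definition admissible :: "'e set" where "admissible = {w. norm (Q w) < \<Delta>}"

lemma open_admissible: "open admissible"
  unfolding admissible_def by (intro open_Collect_less continuous_intros)

definition newton :: "'e \<Rightarrow> 'y \<Rightarrow> 'y" where
  "newton w \<delta> = \<delta> + I (B (R (Q (w - J \<delta>))) - c)"

lemma newton_fixed_iff: "newton w \<delta> = \<delta> \<longleftrightarrow> B (R (Q (w - J \<delta>))) = c"
proof
  assume "newton w \<delta> = \<delta>"
  hence "I (B (R (Q (w - J \<delta>))) - c) = I 0" by (simp add: newton_def)
  from injD[OF I_inj this] show "B (R (Q (w - J \<delta>))) = c" by simp
qed (simp add: newton_def)

lemma point_bound:
  assumes "w \<in> admissible" "norm \<delta> \<le> r"
  shows "norm (Q (w - J \<delta>)) \<le> \<rho>"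
proof -
  have "norm (Q (w - J \<delta>)) \<le> norm (Q w) + norm (Q (J \<delta>))"
    by (simp add: blinfun.diff_right norm_triangle_ineq4)
  also have "norm (Q (J \<delta>)) \<le> KP * (norm B * r)"
    using norm_QJ_le[of \<delta>] assms(2) pos by (meson less_imp_le mult_left_mono order_trans)
  finally show ?thesis using assms(1) by (simp add: admissible_def \<rho>_def)
qed

text \<open>
  Since \<open>I B Q J\<close> is the identity, the linear part of the Newton map cancels, and only the
  deviation of \<open>R\<close> from the identity is left.
\<close>
lemma newton_contraction:
  assumes "w \<in> admissible" "norm \<delta> \<le> r" "norm \<eta> \<le> r"
  shows "norm (newton w \<delta> - newton w \<eta>) \<le> 1 / 2 * norm (\<delta> - \<eta>)"
proof -
  define a where "a = Q (w - J \<delta>)"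
  define b where "b = Q (w - J \<eta>)"
  have ab: "a - b = - Q (J (\<delta> - \<eta>))"
    by (simp add: a_def b_def blinfun.diff_right)
  have "newton w \<delta> - newton w \<eta> = (\<delta> - \<eta>) + I (B (R a - R b))"
    by (simp add: newton_def a_def b_def blinfun.diff_right)
  also have "\<delta> - \<eta> = - I (B (a - b))"
    unfolding ab by (simp only: blinfun.minus_right I_left minus_minus)
  finally have "newton w \<delta> - newton w \<eta> = I (B (R a - R b - (a - b)))"
    by (simp add: blinfun.diff_right)
  hence "norm (newton w \<delta> - newton w \<eta>) \<le> KL * (norm B * norm (R a - R b - (a - b)))"
    using norm_IB_le by metis
  also have "\<dots> \<le> KL * (norm B * (K2 * \<rho> * (KP * (norm B * norm (\<delta> - \<eta>)))))"
  proof (intro mult_left_mono)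
    have "norm (R a - R b - (a - b)) \<le> K2 * \<rho> * norm (a - b)"
      by (rule R_near_identity) (use assms point_bound Q_in in \<open>auto simp: a_def b_def\<close>)
    also have "\<dots> \<le> K2 * \<rho> * (KP * (norm B * norm (\<delta> - \<eta>)))"
      unfolding ab norm_minus_cancel using pos \<rho>_bounds by (intro mult_left_mono norm_QJ_le) auto
    finally show "norm (R a - R b - (a - b)) \<le> K2 * \<rho> * (KP * (norm B * norm (\<delta> - \<eta>)))" .
  qed (use pos in auto)
  also have "\<dots> = KL * (norm B * (K2 * \<rho> * (KP * norm B))) * norm (\<delta> - \<eta>)"
    by (simp add: algebra_simps)
  also have "\<dots> \<le> 1 / 2 * norm (\<delta> - \<eta>)"
    by (rule mult_right_mono[OF \<rho>_bounds(3)]) simp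
  finally show ?thesis .
qed

lemma newton_zero:
  assumes "w \<in> admissible"
  shows "norm (newton w 0) \<le> r / 2"
proof -
  have "norm (Q w) \<le> \<Delta>" using assms by (simp add: admissible_def)
  moreover have "\<Delta> \<le> \<sigma>" using \<Delta> pos by auto
  ultimately have "norm (R (Q w) - R 0) \<le> K1 * norm (Q w - 0)"
    by (intro R_lipschitz) (use Q_in T pos in \<open>auto intro: subspace_0\<close>)
  also have "\<dots> \<le> K1 * \<Delta>" using pos \<open>norm (Q w) \<le> \<Delta>\<close> by simp
  finally have le: "norm (R (Q w) - R 0) \<le> K1 * \<Delta>" .
  have "newton w 0 = I (B (R (Q w) - R 0))"
    using feasible by (simp add: newton_def blinfun.diff_right)
  hence "norm (newton w 0) \<le> KL * (norm B * norm (R (Q w) - R 0))"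
    using norm_IB_le by metis
  also have "\<dots> \<le> KL * (norm B * (K1 * \<Delta>))"
    using le pos by (intro mult_left_mono) auto
  also note displacement_bound
  finally show ?thesis .
qed

lemma solution_exists_unique:
  assumes "w \<in> admissible"
  shows "\<exists>!\<delta>. norm \<delta> \<le> r \<and> B (R (Q (w - J \<delta>))) = c"
proof -
  have "\<exists>!\<delta>\<in>cball 0 r. newton w \<delta> = \<delta>"
  proof (rule Banach_fix)
    show "complete (cball (0 :: 'y) r)" by (simp add: complete_eq_closed)
    show "cball (0 :: 'y) r \<noteq> {}" using r_pos by simp
    show "newton w ` cball 0 r \<subseteq> cball 0 r"
    proof
      fix y assume "y \<in> newton w ` cball 0 r"
      then obtain \<delta> where \<delta>: "norm \<delta> \<le> r" "y = newton w \<delta>" by auto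
      have "norm (newton w \<delta>) \<le> norm (newton w \<delta> - newton w 0) + norm (newton w 0)"
        by (metis diff_add_cancel norm_triangle_ineq)
      moreover have "norm (newton w \<delta> - newton w 0) \<le> 1 / 2 * norm (\<delta> - 0)"
        using newton_contraction[OF assms \<delta>(1), of 0] r_pos by simp
      ultimately show "y \<in> cball 0 r" using newton_zero[OF assms] \<delta> by simp
    qed
    show "dist (newton w \<delta>) (newton w \<eta>) \<le> 1 / 2 * dist \<delta> \<eta>"
      if "\<delta> \<in> cball 0 r" "\<eta> \<in> cball 0 r" for \<delta> \<eta>
      using newton_contraction[OF assms] that by (simp add: dist_norm)
  qed auto
  thus ?thesis by (simp add: newton_fixed_iff)
qed

definition corr :: "'e \<Rightarrow> 'y" where
  "corr w = (THE \<delta>. norm \<delta> \<le> r \<and> B (R (Q (w - J \<delta>))) = c)"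

lemma corr: "w \<in> admissible \<Longrightarrow> norm (corr w) \<le> r" "w \<in> admissible \<Longrightarrow> B (R (Q (w - J (corr w)))) = c"
  using theI'[OF solution_exists_unique] unfolding corr_def by auto

lemma corr_zero: "corr 0 = 0"
proof -
  have "0 \<in> admissible" by (simp add: admissible_def \<Delta>_pos)
  thus ?thesis
    unfolding corr_def using feasible r_pos
    by (intro the1_equality solution_exists_unique) auto
qed

text \<open>
  A fixed point of a family of contractions with factor \<open>1/2\<close> moves at most twice as fast as the
  family.
\<close>
lemma corr_lipschitz:
  assumes w: "w \<in> admissible" and z: "z \<in> admissible"
  shows "norm (corr z - corr w) \<le> 2 * (KL * (norm B * (K1 * KP))) * norm (z - w)"
proof -
  have "newton z (corr w) - newton w (corr w) =
      I (B (R (Q (z - J (corr w))) - R (Q (w - J (corr w)))))"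
    by (simp add: newton_def blinfun.diff_right)
  hence "norm (newton z (corr w) - newton w (corr w)) \<le>
      KL * (norm B * norm (R (Q (z - J (corr w))) - R (Q (w - J (corr w)))))"
    using norm_IB_le by metis
  also have "\<dots> \<le> KL * (norm B * (K1 * (KP * norm (z - w))))"
  proof (intro mult_left_mono)
    have "norm (R (Q (z - J (corr w))) - R (Q (w - J (corr w))))
        \<le> K1 * norm (Q (z - J (corr w)) - Q (w - J (corr w)))"
      by (intro R_lipschitz Q_in order_trans[OF point_bound \<rho>_bounds(2)] w z corr(1))
    also have "\<dots> = K1 * norm (Q (z - w))" by (simp add: blinfun.diff_right)
    also have "\<dots> \<le> K1 * (KP * norm (z - w))"
      using pos by (intro mult_left_mono norm_Q_le) auto
    finally show "norm (R (Q (z - J (corr w))) - R (Q (w - J (corr w)))) \<le> K1 * (KP * norm (z - w))" .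
  qed (use pos in auto)
  finally have 1: "norm (newton z (corr w) - newton w (corr w)) \<le> KL * (norm B * (K1 * KP)) * norm (z - w)"
    by (simp add: algebra_simps)
  have 2: "norm (newton z (corr z) - newton z (corr w)) \<le> 1 / 2 * norm (corr z - corr w)"
    by (intro newton_contraction corr w z)
  have "corr z - corr w = (newton z (corr z) - newton z (corr w)) + (newton z (corr w) - newton w (corr w))"
    using corr(2)[OF w, folded newton_fixed_iff] corr(2)[OF z, folded newton_fixed_iff] by simp
  hence "norm (corr z - corr w) \<le>
      norm (newton z (corr z) - newton z (corr w)) + norm (newton z (corr w) - newton w (corr w))"
    by (metis norm_triangle_ineq)
  thus ?thesis using 1 2 by simp
qed

text \<open>
  The contraction estimate for the derivative: \<open>B DR(u) Q J\<close> differs from \<open>B Q J\<close> so little that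
  \<open>I\<close> is still an approximate inverse with error \<open>1/2\<close>.
\<close>
lemma partial_derivative_invertible:
  assumes u: "u \<in> T" "norm u \<le> \<rho>"
  obtains S where "S o\<^sub>L ((B o\<^sub>L (DR u o\<^sub>L Q)) o\<^sub>L J) = id_blinfun"
    "((B o\<^sub>L (DR u o\<^sub>L Q)) o\<^sub>L J) o\<^sub>L S = id_blinfun" "norm S \<le> 2 * KL"
proof -
  have "norm (y - I (((B o\<^sub>L (DR u o\<^sub>L Q)) o\<^sub>L J) y)) \<le> 1 / 2 * norm y" for y
  proof -
    define h where "h = Q (J y)"
    have h: "h \<in> T" "norm h \<le> KP * (norm B * norm y)" by (auto simp: h_def Q_in norm_QJ_le)
    have "y - I (((B o\<^sub>L (DR u o\<^sub>L Q)) o\<^sub>L J) y) = - I (B (DR u h - h))"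
      by (simp add: h_def blinfun.diff_right I_left)
    hence "norm (y - I (((B o\<^sub>L (DR u o\<^sub>L Q)) o\<^sub>L J) y)) \<le> KL * (norm B * norm (DR u h - h))"
      using norm_IB_le by (metis norm_minus_cancel)
    also have "\<dots> \<le> KL * (norm B * (K2 * \<rho> * (KP * (norm B * norm y))))"
    proof (intro mult_left_mono)
      have "norm (DR u h - h) \<le> K2 * norm u * norm h"
        using u h \<rho>_bounds by (intro DR_near_identity) auto
      also have "\<dots> \<le> K2 * \<rho> * (KP * (norm B * norm y))"
        using u h pos \<rho>_bounds by (intro mult_mono) auto
      finally show "norm (DR u h - h) \<le> K2 * \<rho> * (KP * (norm B * norm y))" .
    qed (use pos in auto)
    also have "\<dots> = KL * (norm B * (K2 * \<rho> * (KP * norm B))) * norm y"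
      by (simp add: algebra_simps)
    also have "\<dots> \<le> 1 / 2 * norm y"
      by (rule mult_right_mono[OF \<rho>_bounds(3)]) simp
    finally show ?thesis .
  qed
  from inverse_of_approximate_inverse[OF I_inj _ _ this] obtain S where
    "S o\<^sub>L ((B o\<^sub>L (DR u o\<^sub>L Q)) o\<^sub>L J) = id_blinfun"
    "((B o\<^sub>L (DR u o\<^sub>L Q)) o\<^sub>L J) o\<^sub>L S = id_blinfun" "norm S \<le> norm I / (1 - 1 / 2)" by auto
  thus ?thesis using that norm_I by auto
qed

theorem corr_C2: "C2_on UNIV admissible corr"
proof -
  have "\<exists>S. S o\<^sub>L ((B o\<^sub>L (DR (Q (w - J (corr w))) o\<^sub>L Q)) o\<^sub>L J) = id_blinfun \<and>
      ((B o\<^sub>L (DR (Q (w - J (corr w))) o\<^sub>L Q)) o\<^sub>L J) o\<^sub>L S = id_blinfun \<and> norm S \<le> 2 * KL"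
    if "w \<in> admissible" for w
    using partial_derivative_invertible[OF Q_in point_bound[OF that corr(1)[OF that]]] by metis
  then obtain S where S: "\<And>w. w \<in> admissible \<Longrightarrow>
      S w o\<^sub>L ((B o\<^sub>L (DR (Q (w - J (corr w))) o\<^sub>L Q)) o\<^sub>L J) = id_blinfun \<and>
      ((B o\<^sub>L (DR (Q (w - J (corr w))) o\<^sub>L Q)) o\<^sub>L J) o\<^sub>L S w = id_blinfun \<and> norm (S w) \<le> 2 * KL"
    by metis
  have F: "has_C2_derivs UNIV UNIV (\<lambda>w. B (R (Q w))) (\<lambda>w. B o\<^sub>L (DR (Q w) o\<^sub>L Q))
      (\<lambda>w. blinfun_compose.prod_right B o\<^sub>L (blinfun_compose.prod_left Q o\<^sub>L (D2R (Q w) o\<^sub>L Q)))"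
    by (rule has_C2_derivs_blinfun_compose[OF has_C2_derivs_compose_projection[OF R_C2 Q_in]])
  show ?thesis
    by (rule implicit_C2[where c = c and J = J and S = S and K = "2 * KL" and d = corr,
          OF open_admissible F _ corr_lipschitz])
      (simp_all only: corr(2) S)
qed

text \<open>
  Correcting the line \<open>t \<mapsto> t v\<close> gives a curve on the constraint set. Its initial velocity is
  \<open>v - Q (J e)\<close> with \<open>e\<close> the derivative of the correction in direction \<open>v\<close>; as \<open>B\<close> annihilates both this velocity
  and \<open>v\<close>, it annihilates \<open>Q (J e)\<close>, so \<open>e = 0\<close>.
\<close>
lemma constrained_curve:
  assumes v: "v \<in> T" "B v = 0"
  obtains \<gamma> \<epsilon> where "\<epsilon> > 0" "\<gamma> C1_differentiable_on {-\<epsilon><..<\<epsilon>}" "\<gamma> ` {-\<epsilon><..<\<epsilon>} \<subseteq> R ` T"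
    "\<forall>t\<in>{-\<epsilon><..<\<epsilon>}. B (\<gamma> t) = c" "\<gamma> 0 = R 0" "(\<gamma> has_vector_derivative v) (at 0)"
proof -
  define \<epsilon> where "\<epsilon> = \<Delta> / (norm v + 1)"
  have \<epsilon>: "\<epsilon> > 0" using \<Delta>_pos by (simp add: \<epsilon>_def add_nonneg_pos)
  have in_admissible: "t *\<^sub>R v \<in> admissible" if "t \<in> {-\<epsilon><..<\<epsilon>}" for t
  proof -
    have "\<bar>t\<bar> * norm v \<le> \<bar>t\<bar> * (norm v + 1)" by (intro mult_left_mono) auto
    also have "\<bar>t\<bar> * (norm v + 1) < \<epsilon> * (norm v + 1)"
      using that by (intro mult_strict_right_mono) (auto simp: add_nonneg_pos)
    also have "\<dots> = \<Delta>"
    proof -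
      have "norm v + 1 \<noteq> 0" using norm_ge_zero[of v] by linarith
      thus ?thesis by (simp add: \<epsilon>_def)
    qed
    finally show ?thesis using Q_id v T by (simp add: admissible_def subspace_mul)
  qed
  obtain d' d'' where d: "has_C2_derivs UNIV admissible corr d' d''"
    using corr_C2 unfolding C2_on_def by blast
  have corr': "(corr has_derivative d' w) (at w)" if "w \<in> admissible" for w
    using d that open_admissible at_within_open[of w admissible] unfolding has_C2_derivs_def by metis
  have cont_d': "continuous_on admissible d'"
    by (rule has_derivative_continuous_on) (use d in \<open>auto simp: has_C2_derivs_def\<close>)
  define H' where "H' w = DR (Q w) o\<^sub>L Q" for w
  have "has_C2_derivs UNIV UNIV (\<lambda>w. R (Q w)) H'
      (\<lambda>w. blinfun_compose.prod_left Q o\<^sub>L (D2R (Q w) o\<^sub>L Q))"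
    unfolding H'_def[abs_def] by (rule has_C2_derivs_compose_projection[OF R_C2 Q_in])
  hence H: "((\<lambda>w. R (Q w)) has_derivative H' w) (at w)" and cont_H': "continuous_on UNIV H'" for w
    unfolding has_C2_derivs_def by (auto intro!: has_derivative_continuous_on)
  define u where "u t = t *\<^sub>R v - J (corr (t *\<^sub>R v))" for t
  define u' where "u' t = v - J (d' (t *\<^sub>R v) v)" for t
  define \<gamma> where "\<gamma> t = R (Q (u t))" for t
  have u: "(u has_vector_derivative u' t) (at t)" if "t \<in> {-\<epsilon><..<\<epsilon>}" for t
  proof -
    have "((\<lambda>t. t *\<^sub>R v) has_derivative (\<lambda>s. s *\<^sub>R v)) (at t)"
      by (auto intro!: derivative_eq_intros)
    from has_derivative_compose[OF this corr'[OF in_admissible[OF that]]]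
    have "((\<lambda>t. corr (t *\<^sub>R v)) has_derivative (\<lambda>s. d' (t *\<^sub>R v) (s *\<^sub>R v))) (at t)" .
    from bounded_linear.has_derivative[OF blinfun.bounded_linear_right this, of J]
    have "((\<lambda>t. J (corr (t *\<^sub>R v))) has_derivative (\<lambda>s. J (d' (t *\<^sub>R v) (s *\<^sub>R v)))) (at t)" .
    hence "(u has_derivative (\<lambda>s. s *\<^sub>R v - J (d' (t *\<^sub>R v) (s *\<^sub>R v)))) (at t)"
      unfolding u_def[abs_def] by (intro has_derivative_diff) (auto intro!: derivative_eq_intros)
    thus ?thesis
      unfolding has_vector_derivative_def u'_def
      by (simp add: blinfun.scaleR_right scaleR_diff_right)
  qed
  have \<gamma>: "(\<gamma> has_vector_derivative H' (u t) (u' t)) (at t)" if "t \<in> {-\<epsilon><..<\<epsilon>}" for t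
    using has_derivative_compose[OF u[OF that, unfolded has_vector_derivative_def] H]
    unfolding has_vector_derivative_def \<gamma>_def[abs_def] by (simp add: blinfun.scaleR_right)
  have cont: "continuous_on {-\<epsilon><..<\<epsilon>} (\<lambda>t. H' (u t) (u' t))"
  proof -
    have "continuous_on {-\<epsilon><..<\<epsilon>} u"
      using u by (meson continuous_at_imp_continuous_on has_vector_derivative_continuous)
    hence "continuous_on {-\<epsilon><..<\<epsilon>} (\<lambda>t. H' (u t))"
      by (rule continuous_on_compose2[OF cont_H']) auto
    moreover have "continuous_on {-\<epsilon><..<\<epsilon>} (\<lambda>t. d' (t *\<^sub>R v))"
      by (rule continuous_on_compose2[OF cont_d']) (use in_admissible in \<open>auto intro!: continuous_intros\<close>)
    ultimately show ?thesis unfolding u'_def[abs_def] by (intro continuous_intros)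
  qed
  have B\<gamma>: "B (\<gamma> t) = c" if "t \<in> {-\<epsilon><..<\<epsilon>}" for t
    using corr(2)[OF in_admissible[OF that]] by (simp add: \<gamma>_def u_def)
  have 0: "0 \<in> {-\<epsilon><..<\<epsilon>}" using \<epsilon> by simp
  have u0: "u 0 = 0" by (simp add: u_def corr_zero)
  define e where "e = d' 0 v"
  have D0: "H' (u 0) (u' 0) = v - Q (J e)"
  proof -
    have "u' 0 = v - J e" by (simp add: u'_def e_def)
    hence "H' (u 0) (u' 0) = DR 0 (Q (v - J e))" by (simp add: H'_def u0)
    also have "\<dots> = Q (v - J e)" by (rule DR_zero[OF Q_in])
    also have "\<dots> = v - Q (J e)" by (simp add: blinfun.diff_right Q_id[OF v(1)])
    finally show ?thesis .
  qed
  have "((\<lambda>t. B (\<gamma> t)) has_vector_derivative B (v - Q (J e))) (at 0)"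
    using bounded_linear.has_vector_derivative[OF blinfun.bounded_linear_right \<gamma>[OF 0], of B] D0
    by simp
  moreover have "((\<lambda>t. B (\<gamma> t)) has_vector_derivative 0) (at 0)"
    by (rule has_vector_derivative_transform_within_open[OF has_vector_derivative_const[of c], of "{-\<epsilon><..<\<epsilon>}"])
      (use B\<gamma> 0 in auto)
  ultimately have "B (v - Q (J e)) = 0" by (rule vector_derivative_unique_at)
  hence "B (Q (J e)) = 0" using v by (simp add: blinfun.diff_right)
  hence "e = 0" using I_left[of e] by simp
  hence "(\<gamma> has_vector_derivative v) (at 0)" using \<gamma>[OF 0] D0 by simp
  moreover have "\<gamma> C1_differentiable_on {-\<epsilon><..<\<epsilon>}"
    unfolding C1_differentiable_on_def using \<gamma> cont
    by (intro exI[of _ "\<lambda>t. H' (u t) (u' t)"]) auto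
  moreover have "\<gamma> ` {-\<epsilon><..<\<epsilon>} \<subseteq> R ` T" using Q_in by (auto simp: \<gamma>_def)
  moreover have "\<gamma> 0 = R 0" by (simp add: \<gamma>_def u0)
  ultimately show ?thesis using that[OF \<epsilon>, of \<gamma>] B\<gamma> by blast
qed

end

section \<open>Tangent vectors of the constraint set\<close>

lemma tangent_space_constraint_subset:
  assumes "v \<in> tangent_space (constraint_set M B c) x"
  shows "v \<in> tangent_space M x" "blinfun_apply B v = 0"
proof -
  obtain \<gamma> \<epsilon> where \<gamma>: "\<epsilon> > 0" "\<gamma> C1_differentiable_on {-\<epsilon><..<\<epsilon>}"
    "\<gamma> ` {-\<epsilon><..<\<epsilon>} \<subseteq> constraint_set M B c" "\<gamma> 0 = x" "(\<gamma> has_vector_derivative v) (at 0)"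
    using assms unfolding tangent_space_def by blast
  have "constraint_set M B c \<subseteq> M" by (auto simp: constraint_set_def)
  thus "v \<in> tangent_space M x"
    using \<gamma> unfolding tangent_space_def by blast
  have "((\<lambda>t. B (\<gamma> t)) has_vector_derivative B v) (at 0)"
    by (rule bounded_linear.has_vector_derivative[OF blinfun.bounded_linear_right \<gamma>(5)])
  moreover have "((\<lambda>t. B (\<gamma> t)) has_vector_derivative 0) (at 0)"
    by (rule has_vector_derivative_transform_within_open[OF has_vector_derivative_const[of c], of "{-\<epsilon><..<\<epsilon>}"])
      (use \<gamma> in \<open>auto simp: constraint_set_def image_subset_iff\<close>)
  ultimately show "B v = 0" by (rule vector_derivative_unique_at)
qed

section \<open>Regularity of the correction map\<close>

theorem theorem5p2:
  fixes M X :: "'e::{real_inner, complete_space} set"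
    and B :: "'e \<Rightarrow>\<^sub>L 'y::{real_inner, complete_space}" and c :: 'y
    and P :: "'e \<Rightarrow> 'e \<Rightarrow>\<^sub>L 'e"
    and R :: "'e \<Rightarrow> 'e \<Rightarrow> 'e"
    and DR :: "'e \<Rightarrow> 'e \<Rightarrow> 'e \<Rightarrow>\<^sub>L 'e"
    and D2R :: "'e \<Rightarrow> 'e \<Rightarrow> 'e \<Rightarrow>\<^sub>L 'e \<Rightarrow>\<^sub>L 'e"
    and K\<^sub>P K\<^sub>L \<sigma> K\<^sub>1 K\<^sub>2 r \<Delta>\<^sub>s :: real
  assumes Y_nontrivial: "\<exists>y::'y. y \<noteq> 0"
    and M: "C2_submanifold M"
    and B_surj: "surj (blinfun_apply B)"
    and MB_nonempty: "constraint_set M B c \<noteq> {}"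
    and P_projection: "\<And>x. x \<in> M \<Longrightarrow>
          range (blinfun_apply (P x)) = tangent_space M x \<and> (\<forall>v\<in>tangent_space M x. P x v = v)"
    and R_maps: "\<And>x. x \<in> M \<Longrightarrow> R x ` tangent_space M x \<subseteq> M"
    and R_C2: "\<And>x. x \<in> M \<Longrightarrow>
          has_C2_derivs (tangent_space M x) (tangent_space M x) (R x) (DR x) (D2R x)"
    and R_zero: "\<And>x. x \<in> M \<Longrightarrow> R x 0 = x"
    and DR_zero: "\<And>x v. x \<in> M \<Longrightarrow> v \<in> tangent_space M x \<Longrightarrow> DR x 0 v = v"
    and A1: "\<And>S. S \<subseteq> constraint_set M B c \<Longrightarrow> bounded S \<Longrightarrow>
          \<exists>C>0. \<forall>x\<in>S. \<forall>\<delta>. schur_op B P x \<delta> \<bullet> \<delta> \<ge> C * (norm \<delta>)\<^sup>2"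
    and A2_cont: "continuous_on M P"
    and A2_bounded: "\<And>S. S \<subseteq> M \<Longrightarrow> bounded S \<Longrightarrow> bounded (P ` S)"
    and A3: "\<And>S. S \<subseteq> M \<Longrightarrow> bounded S \<Longrightarrow>
          \<exists>s>0. \<exists>k1>0. \<exists>k2>0. retraction_bounds M DR D2R S s k1 k2"
    and X: "X \<subseteq> constraint_set M B c" "bounded X"
    and K\<^sub>P: "K\<^sub>P > 0" "\<And>x. x \<in> X \<Longrightarrow> norm (P x) \<le> K\<^sub>P"
    and K\<^sub>L: "K\<^sub>L > 0" "\<And>x. x \<in> X \<Longrightarrow> onorm (inv (schur_op B P x)) \<le> K\<^sub>L"
    and R_bounds_X: "\<sigma> > 0" "K\<^sub>1 > 0" "K\<^sub>2 > 0" "retraction_bounds M DR D2R X \<sigma> K\<^sub>1 K\<^sub>2"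
    and r: "r = min (\<sigma> / (2 * K\<^sub>P * norm B)) (1 / (4 * K\<^sub>2 * K\<^sub>L * K\<^sub>P\<^sup>2 * norm B ^ 3))"
    and \<Delta>\<^sub>s: "\<Delta>\<^sub>s = min (\<sigma> / 2)
              (min (1 / (4 * K\<^sub>2 * K\<^sub>L * K\<^sub>P * (norm B)\<^sup>2)) (r / (2 * K\<^sub>1 * K\<^sub>L * norm B)))"
  shows "\<forall>x\<in>X. C2_on (tangent_space (constraint_set M B c) x)
           {v \<in> tangent_space (constraint_set M B c) x. norm v < \<Delta>\<^sub>s}
           (correction B c P R r x)"
proof
  fix x assume x: "x \<in> X"
  define T where "T = tangent_space M x"
  define J where "J = Blinfun (adjoint B)"
  define T0 where "T0 = tangent_space (constraint_set M B c) x"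
  have xM: "x \<in> M" "B x = c" using x X by (auto simp: constraint_set_def)
  have J: "J y = adjoint B y" for y
    unfolding J_def by (simp add: bounded_linear_Blinfun_apply[OF bounded_linear_adjoint])
  have B_pos: "norm B > 0"
  proof -
    have "B \<noteq> 0"
    proof
      assume "B = 0"
      hence "blinfun_apply B w = 0" for w by simp
      thus False using B_surj Y_nontrivial unfolding surj_def by metis
    qed
    thus ?thesis by simp
  qed
  define L where "L = B o\<^sub>L (P x o\<^sub>L J)"
  have L: "blinfun_apply L = schur_op B P x"
    by (auto simp: L_def schur_op_def J)
  obtain C where C: "C > 0" "\<And>z. L z \<bullet> z \<ge> C * (norm z)\<^sup>2"
    using A1[OF X] x unfolding L by blast
  obtain I where I: "I o\<^sub>L L = id_blinfun" "L o\<^sub>L I = id_blinfun"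
    using lax_milgram[OF C] by blast
  have IL: "I (L y) = y" and LI: "L (I y) = y" for y
    using I by (metis blinfun_apply_blinfun_compose blinfun_apply_id_blinfun)+
  have "inv (schur_op B P x) = blinfun_apply I"
    unfolding L[symmetric] by (rule inv_unique_comp) (auto simp: IL LI)
  hence norm_I: "norm I \<le> K\<^sub>L" using K\<^sub>L(2)[OF x] by (simp add: norm_blinfun.rep_eq)
  have T_simps: "P x w \<in> T" "v \<in> T \<Longrightarrow> P x v = v" for v w
    using P_projection[OF xM(1)] unfolding T_def by auto
  interpret constrained_retraction T "P x" B J I c "R x" "DR x" "D2R x" K\<^sub>P K\<^sub>L \<sigma> K\<^sub>1 K\<^sub>2 r \<Delta>\<^sub>s
  proof
    show "has_C2_derivs T T (R x) (DR x) (D2R x)" using R_C2[OF xM(1)] by (simp add: T_def)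
    show "P x w \<in> T" "v \<in> T \<Longrightarrow> P x v = v" for v w by (fact T_simps)+
    show "v \<in> T \<Longrightarrow> DR x 0 v = v" for v using DR_zero[OF xM(1)] by (simp add: T_def)
    show "B (R x 0) = c" using R_zero[OF xM(1)] xM(2) by simp
    show "I (B (P x (J y))) = y" for y using IL[of y] by (simp add: L_def)
    show "inj I" by (metis LI injI)
    show "norm (P x) \<le> K\<^sub>P" by (rule K\<^sub>P(2)[OF x])
    show "norm J \<le> norm B" by (rule norm_blinfun_bound) (simp_all add: J norm_adjoint_le)
    show "norm I \<le> K\<^sub>L" by (fact norm_I)
    show "norm (DR x u v) \<le> K\<^sub>1 * norm v" if "u \<in> T" "norm u \<le> \<sigma>" "v \<in> T" for u v
      using R_bounds_X(4) x that unfolding retraction_bounds_def T_def by blast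
    show "norm (D2R x u v w) \<le> K\<^sub>2 * norm v * norm w"
      if "u \<in> T" "norm u \<le> \<sigma>" "v \<in> T" "w \<in> T" for u v w
      using R_bounds_X(4) x that unfolding retraction_bounds_def T_def by blast
  qed (fact K\<^sub>P K\<^sub>L R_bounds_X B_pos r \<Delta>\<^sub>s)+
  \<comment> \<open>Subspace and closedness are part of being \<open>C\<^sup>2\<close> on \<open>T0\<close>; the definition by curves shows neither.\<close>
  have T0: "T0 = T \<inter> {v. B v = 0}"
  proof
    show "T0 \<subseteq> T \<inter> {v. B v = 0}"
      unfolding T0_def T_def using tangent_space_constraint_subset by blast
    show "T \<inter> {v. B v = 0} \<subseteq> T0"
    proof
      fix v assume "v \<in> T \<inter> {v. B v = 0}"
      hence v: "v \<in> T" "B v = 0" by auto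
      obtain \<gamma> \<epsilon> where \<gamma>: "\<epsilon> > 0" "\<gamma> C1_differentiable_on {-\<epsilon><..<\<epsilon>}" "\<gamma> ` {-\<epsilon><..<\<epsilon>} \<subseteq> R x ` T"
        "\<forall>t\<in>{-\<epsilon><..<\<epsilon>}. B (\<gamma> t) = c" "\<gamma> 0 = R x 0" "(\<gamma> has_vector_derivative v) (at 0)"
        by (rule constrained_curve[OF v])
      have "\<gamma> ` {-\<epsilon><..<\<epsilon>} \<subseteq> constraint_set M B c"
        using \<gamma>(3,4) R_maps[OF xM(1)] unfolding constraint_set_def T_def by blast
      thus "v \<in> T0"
        unfolding T0_def tangent_space_def using \<gamma> R_zero[OF xM(1)] by auto
    qed
  qed
  have "closed T0" "subspace T0"
  proof -
    have "closed {v. B v = 0}" by (intro closed_Collect_eq continuous_intros)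
    thus "closed T0" unfolding T0 using T(2) by (rule closed_Int[rotated])
    have "subspace {v. B v = 0}"
      by (auto simp: subspace_def blinfun.add_right blinfun.scaleR_right)
    thus "subspace T0" unfolding T0 using T(1) by (rule subspace_inter[rotated])
  qed
  have "C2_on T0 {v \<in> T0. norm v < \<Delta>\<^sub>s} (correction B c P R r x)"
  proof (rule C2_on_subset[OF corr_C2 \<open>subspace T0\<close> \<open>closed T0\<close>])
    have "{v \<in> T0. norm v < \<Delta>\<^sub>s} = T0 \<inter> ball 0 \<Delta>\<^sub>s" by auto
    thus "openin (top_of_set T0) {v \<in> T0. norm v < \<Delta>\<^sub>s}" by (simp add: openin_open_Int)
    show "{v \<in> T0. norm v < \<Delta>\<^sub>s} \<subseteq> admissible" by (auto simp: T0 admissible_def T_simps)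
    show "correction B c P R r x v = corr v" if "v \<in> {v \<in> T0. norm v < \<Delta>\<^sub>s}" for v
      using that by (simp add: correction_def corr_def T0 T_simps J blinfun.diff_right)
  qed
  thus "C2_on (tangent_space (constraint_set M B c) x)
      {v \<in> tangent_space (constraint_set M B c) x. norm v < \<Delta>\<^sub>s} (correction B c P R r x)"
    by (simp add: T0_def)
qed

end
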